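(* The problem Query Readiness (given an instance $I$, a set $\Pi$ of procedures, and a boolean conjunctive query $Q$, is there a sequence $P_1,\dots,P_n$ of procedures in $\Pi$ such that all the instances in $\mathrm{outcomes}_{P_1,\dots,P_n}(I)$ satisfy $Q$?) is undecidable, even if $\Pi$ is a set of procedures with safe scope and $Q$ is a query of one atom.
   Context: Fix disjoint countably infinite sets of attribute names (totally ordered), domain values $D$, and relation names. A schema $S$ is a partial function with finite domain from relation names to finite sets of attributes; "$R$ is in $S$" means $S(R)$ is defined. An instance $I$ of $S$ assigns to each $R$ in $S$ a finite set $R^I$ of tuples, i.e. functions $S(R)\to D$ (also written as value lists in attribute order). A named atom $R(A_1:x_1,\dots,A_k:x_k)$ (the $x_i$ are variables) is compatible with $S$ if $\{A_1,\dots,A_k\}\subseteq S(R)$; $(I,\tau)$ satisfies it if some $t\in R^I$ has $t(A_i)=\tau(x_i)$ for all $i$. A conjunctive query (CQ) is $\exists \bar z\,\phi(\bar z,\bar y)$ with $\phi$ a conjunction of named atoms (boolean if $\bar y$ is empty); it is compatible with $S$ if all its atoms are, and $Q(I)$ is its set of answers $\tau(\bar y)$. A total query is a relation name $R$; it is compatible with $S$ if $R$ is in $S$, and its result is the set of all (unnamed) tuples in $R^I$. A tgd is $\forall \bar x(\exists \bar y\,\phi(\bar x,\bar y)\to\exists\bar z\,\psi(\bar x,\bar z))$, where $\phi,\psi$ are conjunctions of named atoms. $I\models\Sigma$ means that every CQ in $\Sigma$ is compatible with the schema of $I$ and every dependency in $\Sigma$ holds in $I$ in the usual first-order sense. A set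 of tgds is acyclic if the directed graph on relation names with an edge from $R$ to $R'$ whenever some tgd in the set has $R$ on the left-hand side and $R'$ on the right-hand side is acyclic. A structure constraint is $R[\bar s]$ ($\bar s$ a tuple of attributes) or $R[*]$. A procedure is $P=(\mathrm{Scope},C_{in},C_{out},Q_{pres})$: $\mathrm{Scope}$ is a set of structure constraints, $C_{in}$ and $C_{out}$ (pre- and postconditions) are sets of constraints, and $Q_{pres}$ is a set of queries. $P$ is applicable on $I$ over $S$ if each query in $Q_{pres}$ is compatible with $S$ and $I\models C_{in}$. An instance $I'$ over the same schema $S$ is a possible outcome of applying $P$ to $I$ if (1) $P$ is applicable on $I$; (2) $I'\models C_{out}$; (3) $I$ and $I'$ agree outside the scope: $R^I=R^{I'}$ for every $R$ in $S$ not mentioned in $\mathrm{Scope}$, and for every $T$ in $S$ mentioned in $\mathrm{Scope}$ with $T[*]\notin\mathrm{Scope}$, the projections of $T^I$ and $T^{I'}$ onto the attributes of $S(T)$ not mentioned in any $T[\bar s]\in\mathrm{Scope}$ coincide; (4) $Q(I)\subseteq Q(I')$ for each $Q\in Q_{pres}$. $\mathrm{outcomes}_P(I)$ is the set of all possible outcomes; for a set $\mathcal I$ of instances, $\mathrm{outcomes}_P(\mathcal I)=\bigcup_{I\in\mathcal I}\mathrm{outcomes}_P(I)$; and $\mathrm{outcomes}_{P_1,\dots,P_n}(I)=\mathrm{outcomes}_{P_n}(\cdots(\mathrm{outcomes}_{P_1}(I))\cdots)$. $P$ has safe scope if: $C_{in}=\emptyset$; $C_{out}$ is an acyclic set of tgds;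 $\mathrm{Scope}$ consists of exactly one constraint $R[*]$ for each relation $R$ appearing on the right-hand side of a tgd in $C_{out}$; and $Q_{pres}$ consists of one total query $R$ for each $R[*]\in\mathrm{Scope}$. In the readiness problem the length $n$ is not part of the input, and procedures of $\Pi$ may be repeated in the sequence. *)

theory Defs
  imports Main "HOL-Library.Nat_Bijection"
begin

section \<open>Names, schemas and instances\<close>

text \<open>Separate types keep the three countably infinite sets of names disjoint.\<close>

datatype attr = Attr (attr_no: nat)
datatype val = Val (val_no: nat)
datatype rel = Rel (rel_no: nat)

instantiation attr :: linorder
begin

definition less_eq_attr :: "attr \<Rightarrow> attr \<Rightarrow> bool" where
  "A \<le> B \<longleftrightarrow> attr_no A \<le> attr_no B"

definition less_attr :: "attr \<Rightarrow> attr \<Rightarrow> bool" where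
  "A < B \<longleftrightarrow> attr_no A < attr_no B"

instance
  by standard (auto simp: less_eq_attr_def less_attr_def attr.expand)

end

type_synonym var = nat
type_synonym tuple = "attr \<rightharpoonup> val"
type_synonym schema = "rel \<rightharpoonup> attr set"

text \<open>An instance carries its schema, which its (possibly empty) relations do not determine.\<close>

record db =
  sch :: schema
  ext :: "rel \<Rightarrow> tuple set"

definition is_schema :: "schema \<Rightarrow> bool" where
  "is_schema S \<longleftrightarrow> finite (dom S) \<and> (\<forall>R A. S R = Some A \<longrightarrow> finite A)"

text \<open>Relation names outside the schema have no extension; they are mapped to the empty set.\<close>

definition is_instance :: "db \<Rightarrow> bool" where
  "is_instance I \<longleftrightarrow> is_schema (sch I) \<and>
     (\<forall>R. case sch I R of
        None \<Rightarrow> ext I R = {}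
      | Some A \<Rightarrow> finite (ext I R) \<and> (\<forall>t\<in>ext I R. dom t = A))"


section \<open>Queries and dependencies\<close>

datatype atom = Atom (atom_rel: rel) (atom_args: "(attr \<times> var) list")

text \<open>
  \<open>CQ ys as\<close> has the free variables \<open>ys\<close>; all other variables of \<open>as\<close> are existentially
  quantified.  In \<open>TGD xs l r\<close> the variables \<open>xs\<close> are the universally quantified ones; the other
  variables of \<open>l\<close> and of \<open>r\<close> are existentially quantified, separately on each side.
\<close>

datatype cq = CQ (cq_free: "var list") (cq_atoms: "atom list")

datatype tgd = TGD (tgd_vars: "var list") (tgd_lhs: "atom list") (tgd_rhs: "atom list")

datatype query = Conj cq | Total rel

datatype constr = Dep tgd | Pattern cq

datatype sconstr = Attrs rel "attr list" | Star rel

definition atoms_vars :: "atom list \<Rightarrow> var set" where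
  "atoms_vars as = (\<Union>a\<in>set as. snd ` set (atom_args a))"

definition wf_atom :: "atom \<Rightarrow> bool" where
  "wf_atom a \<longleftrightarrow> distinct (map fst (atom_args a))"

definition wf_conj :: "atom list \<Rightarrow> bool" where
  "wf_conj as \<longleftrightarrow> as \<noteq> [] \<and> (\<forall>a\<in>set as. wf_atom a)"

definition wf_cq :: "cq \<Rightarrow> bool" where
  "wf_cq q \<longleftrightarrow> wf_conj (cq_atoms q) \<and> set (cq_free q) \<subseteq> atoms_vars (cq_atoms q)"

definition wf_tgd :: "tgd \<Rightarrow> bool" where
  "wf_tgd s \<longleftrightarrow> wf_conj (tgd_lhs s) \<and> wf_conj (tgd_rhs s) \<and>
     set (tgd_vars s) \<subseteq> atoms_vars (tgd_lhs s)"

fun wf_query :: "query \<Rightarrow> bool" where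
  "wf_query (Conj q) \<longleftrightarrow> wf_cq q"
| "wf_query (Total R) \<longleftrightarrow> True"

fun wf_constr :: "constr \<Rightarrow> bool" where
  "wf_constr (Dep s) \<longleftrightarrow> wf_tgd s"
| "wf_constr (Pattern q) \<longleftrightarrow> wf_cq q"

definition boolean :: "cq \<Rightarrow> bool" where
  "boolean q \<longleftrightarrow> cq_free q = []"

definition compatible_atoms :: "atom list \<Rightarrow> schema \<Rightarrow> bool" where
  "compatible_atoms as S \<longleftrightarrow>
     (\<forall>a\<in>set as. \<exists>A. S (atom_rel a) = Some A \<and> fst ` set (atom_args a) \<subseteq> A)"

fun compatible :: "query \<Rightarrow> schema \<Rightarrow> bool" where
  "compatible (Conj q) S \<longleftrightarrow> compatible_atoms (cq_atoms q) S"
| "compatible (Total R) S \<longleftrightarrow> R \<in> dom S"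

definition sat_atom :: "db \<Rightarrow> (var \<Rightarrow> val) \<Rightarrow> atom \<Rightarrow> bool" where
  "sat_atom I \<tau> a \<longleftrightarrow>
     (\<exists>t\<in>ext I (atom_rel a). \<forall>(A, x)\<in>set (atom_args a). t A = Some (\<tau> x))"

definition sat_atoms :: "db \<Rightarrow> (var \<Rightarrow> val) \<Rightarrow> atom list \<Rightarrow> bool" where
  "sat_atoms I \<tau> as \<longleftrightarrow> (\<forall>a\<in>set as. sat_atom I \<tau> a)"

text \<open>The unnamed form of a tuple lists its values in the order of its attributes.\<close>

definition unnamed :: "tuple \<Rightarrow> val list" where
  "unnamed t = map (\<lambda>A. the (t A)) (sorted_list_of_set (dom t))"

fun answers :: "query \<Rightarrow> db \<Rightarrow> val list set" where
  "answers (Conj q) I = {map \<tau> (cq_free q) |\<tau>. sat_atoms I \<tau> (cq_atoms q)}"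
| "answers (Total R) I = unnamed ` ext I R"

definition satisfies :: "db \<Rightarrow> cq \<Rightarrow> bool" where
  "satisfies I q \<longleftrightarrow> [] \<in> answers (Conj q) I"

definition tgd_holds :: "db \<Rightarrow> tgd \<Rightarrow> bool" where
  "tgd_holds I s \<longleftrightarrow>
     (\<forall>\<tau>. (\<exists>\<tau>'. (\<forall>x\<in>set (tgd_vars s). \<tau>' x = \<tau> x) \<and> sat_atoms I \<tau>' (tgd_lhs s)) \<longrightarrow>
          (\<exists>\<tau>'. (\<forall>x\<in>set (tgd_vars s). \<tau>' x = \<tau> x) \<and> sat_atoms I \<tau>' (tgd_rhs s)))"

text \<open>
  The conjunctive queries occurring in a set of constraints include the two sides of its tgds.  A
  query standing on its own as a constraint demands compatibility only.
\<close>

fun sat_constr :: "db \<Rightarrow> constr \<Rightarrow> bool" where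
  "sat_constr I (Dep s) \<longleftrightarrow>
     compatible_atoms (tgd_lhs s) (sch I) \<and> compatible_atoms (tgd_rhs s) (sch I) \<and> tgd_holds I s"
| "sat_constr I (Pattern q) \<longleftrightarrow> compatible_atoms (cq_atoms q) (sch I)"

definition sat_constrs :: "db \<Rightarrow> constr set \<Rightarrow> bool" where
  "sat_constrs I C \<longleftrightarrow> (\<forall>c\<in>C. sat_constr I c)"

definition tgd_edges :: "tgd set \<Rightarrow> (rel \<times> rel) set" where
  "tgd_edges T = (\<Union>s\<in>T. (atom_rel ` set (tgd_lhs s)) \<times> (atom_rel ` set (tgd_rhs s)))"


section \<open>Procedures and their outcomes\<close>

record proc =
  scope :: "sconstr set"
  c_in :: "constr set"
  c_out :: "constr set"
  q_pres :: "query set"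

definition wf_proc :: "proc \<Rightarrow> bool" where
  "wf_proc P \<longleftrightarrow> finite (scope P) \<and>
     finite (c_in P) \<and> (\<forall>c\<in>c_in P. wf_constr c) \<and>
     finite (c_out P) \<and> (\<forall>c\<in>c_out P. wf_constr c) \<and>
     finite (q_pres P) \<and> (\<forall>q\<in>q_pres P. wf_query q)"

definition applicable :: "proc \<Rightarrow> db \<Rightarrow> bool" where
  "applicable P I \<longleftrightarrow> (\<forall>q\<in>q_pres P. compatible q (sch I)) \<and> sat_constrs I (c_in P)"

definition scope_rels :: "sconstr set \<Rightarrow> rel set" where
  "scope_rels C = {R. Star R \<in> C \<or> (\<exists>s. Attrs R s \<in> C)}"

definition scope_attrs :: "sconstr set \<Rightarrow> rel \<Rightarrow> attr set" where
  "scope_attrs C R = (\<Union>{set s |s. Attrs R s \<in> C})"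

definition agree_outside :: "sconstr set \<Rightarrow> db \<Rightarrow> db \<Rightarrow> bool" where
  "agree_outside C I I' \<longleftrightarrow>
     (\<forall>R A. sch I R = Some A \<longrightarrow>
        (R \<notin> scope_rels C \<longrightarrow> ext I R = ext I' R) \<and>
        (R \<in> scope_rels C \<and> Star R \<notin> C \<longrightarrow>
           (\<lambda>t. t |` (A - scope_attrs C R)) ` ext I R = (\<lambda>t. t |` (A - scope_attrs C R)) ` ext I' R))"

definition outcomes :: "proc \<Rightarrow> db \<Rightarrow> db set" where
  "outcomes P I = {I'. is_instance I' \<and> sch I' = sch I \<and>
     applicable P I \<and>
     sat_constrs I' (c_out P) \<and>
     agree_outside (scope P) I I' \<and>
     (\<forall>q\<in>q_pres P. answers q I \<subseteq> answers q I')}"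

definition outcomes_set :: "proc \<Rightarrow> db set \<Rightarrow> db set" where
  "outcomes_set P X = (\<Union>I\<in>X. outcomes P I)"

definition outcomes_seq :: "proc list \<Rightarrow> db \<Rightarrow> db set" where
  "outcomes_seq Ps I = fold outcomes_set Ps {I}"

definition safe_scope :: "proc \<Rightarrow> bool" where
  "safe_scope P \<longleftrightarrow>
     c_in P = {} \<and>
     (\<exists>T. c_out P = Dep ` T \<and> acyclic (tgd_edges T) \<and>
          scope P = Star ` (\<Union>s\<in>T. atom_rel ` set (tgd_rhs s))) \<and>
     q_pres P = Total ` {R. Star R \<in> scope P}"


section \<open>The query readiness problem\<close>

type_synonym readiness_input = "db \<times> proc set \<times> cq"

definition readiness_inputs :: "readiness_input set" where
  "readiness_inputs = {(I, \<Pi>, Q). is_instance I \<and>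
     finite \<Pi> \<and> (\<forall>P\<in>\<Pi>. wf_proc P) \<and> wf_cq Q \<and> boolean Q}"

definition query_readiness :: "readiness_input set" where
  "query_readiness = {(I, \<Pi>, Q).
     \<exists>Ps. Ps \<noteq> [] \<and> set Ps \<subseteq> \<Pi> \<and> (\<forall>I'\<in>outcomes_seq Ps I. satisfies I' Q)}"


section \<open>Coding of inputs\<close>

text \<open>
  Finite syntactic objects are coded by Cantor pairing and its extension to sums and lists.  A
  number codes a finite set if the list it decodes to enumerates codes of the elements, in any
  order and with repetitions allowed, so an input has many codes.
\<close>

definition codes_pair ::
  "('a \<Rightarrow> nat \<Rightarrow> bool) \<Rightarrow> ('b \<Rightarrow> nat \<Rightarrow> bool) \<Rightarrow> 'a \<times> 'b \<Rightarrow> nat \<Rightarrow> bool" where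
  "codes_pair r s p n \<longleftrightarrow> r (fst p) (fst (prod_decode n)) \<and> s (snd p) (snd (prod_decode n))"

definition codes_set :: "('a \<Rightarrow> nat \<Rightarrow> bool) \<Rightarrow> 'a set \<Rightarrow> nat \<Rightarrow> bool" where
  "codes_set r X n \<longleftrightarrow> rel_set r X (set (list_decode n))"

definition codes_by :: "('a \<Rightarrow> nat) \<Rightarrow> 'a \<Rightarrow> nat \<Rightarrow> bool" where
  "codes_by e x n \<longleftrightarrow> n = e x"

fun enc_atom :: "atom \<Rightarrow> nat" where
  "enc_atom (Atom R args) = prod_encode (rel_no R,
     list_encode (map (\<lambda>(A, x). prod_encode (attr_no A, x)) args))"

definition enc_atoms :: "atom list \<Rightarrow> nat" where
  "enc_atoms as = list_encode (map enc_atom as)"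

fun enc_cq :: "cq \<Rightarrow> nat" where
  "enc_cq (CQ ys as) = prod_encode (list_encode ys, enc_atoms as)"

fun enc_tgd :: "tgd \<Rightarrow> nat" where
  "enc_tgd (TGD xs l r) = prod_encode (list_encode xs, prod_encode (enc_atoms l, enc_atoms r))"

fun enc_query :: "query \<Rightarrow> nat" where
  "enc_query (Conj q) = sum_encode (Inl (enc_cq q))"
| "enc_query (Total R) = sum_encode (Inr (rel_no R))"

fun enc_constr :: "constr \<Rightarrow> nat" where
  "enc_constr (Dep s) = sum_encode (Inl (enc_tgd s))"
| "enc_constr (Pattern q) = sum_encode (Inr (enc_cq q))"

fun enc_sconstr :: "sconstr \<Rightarrow> nat" where
  "enc_sconstr (Attrs R s) = sum_encode (Inl (prod_encode (rel_no R, list_encode (map attr_no s))))"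
| "enc_sconstr (Star R) = sum_encode (Inr (rel_no R))"

definition codes_tuple :: "tuple \<Rightarrow> nat \<Rightarrow> bool" where
  "codes_tuple t = codes_set (codes_pair (codes_by attr_no) (codes_by val_no)) (Map.graph t)"

definition codes_db :: "db \<Rightarrow> nat \<Rightarrow> bool" where
  "codes_db I =
     codes_set
       (codes_pair (codes_by rel_no) (codes_pair (codes_set (codes_by attr_no)) (codes_set codes_tuple)))
       {(R, A, ext I R) |R A. sch I R = Some A}"

definition codes_proc :: "proc \<Rightarrow> nat \<Rightarrow> bool" where
  "codes_proc P =
     codes_pair (codes_set (codes_by enc_sconstr))
       (codes_pair (codes_set (codes_by enc_constr))
         (codes_pair (codes_set (codes_by enc_constr)) (codes_set (codes_by enc_query))))
       (scope P, c_in P, c_out P, q_pres P)"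

definition codes_input :: "readiness_input \<Rightarrow> nat \<Rightarrow> bool" where
  "codes_input = codes_pair codes_db (codes_pair (codes_set codes_proc) (codes_by enc_cq))"


text \<open>Every input has a code, and no two inputs share one.\<close>

lemma codes_pair_ex: "\<exists>n. r (fst p) n \<Longrightarrow> \<exists>n. s (snd p) n \<Longrightarrow> \<exists>n. codes_pair r s p n"
  unfolding codes_pair_def by (metis prod_encode_inverse fst_conv snd_conv)

lemma codes_by_ex: "\<exists>n. codes_by e x n"
  unfolding codes_by_def by simp

lemma codes_set_ex:
  assumes "finite X" "\<And>x. x \<in> X \<Longrightarrow> \<exists>n. r x n"
  shows "\<exists>n. codes_set r X n"
proof -
  obtain c where c: "\<And>x. x \<in> X \<Longrightarrow> r x (c x)" using assms(2) by metis
  obtain xs where xs: "set xs = X" using assms(1) finite_list by blast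
  have "codes_set r X (list_encode (map c xs))"
    using c xs by (auto simp: codes_set_def rel_set_def)
  then show ?thesis by blast
qed

lemma codes_tuple_ex:
  assumes "finite (dom t)"
  shows "\<exists>n. codes_tuple t n"
  unfolding codes_tuple_def using assms
  by (intro codes_set_ex codes_pair_ex codes_by_ex) (simp add: finite_graph_iff_finite_dom)

lemma codes_db_ex:
  assumes "is_instance I"
  shows "\<exists>n. codes_db I n"
proof -
  have S: "is_schema (sch I)" and T: "\<And>R. case sch I R of None \<Rightarrow> ext I R = {}
      | Some A \<Rightarrow> finite (ext I R) \<and> (\<forall>t\<in>ext I R. dom t = A)"
    using assms unfolding is_instance_def by blast+
  have "{(R, A, ext I R) |R A. sch I R = Some A} = (\<lambda>R. (R, the (sch I R), ext I R)) ` dom (sch I)"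
    by (force simp: dom_def)
  then have fin: "finite {(R, A, ext I R) |R A. sch I R = Some A}"
    using S by (simp add: is_schema_def)
  show ?thesis
    unfolding codes_db_def
  proof (rule codes_set_ex[OF fin])
    fix x assume "x \<in> {(R, A, ext I R) |R A. sch I R = Some A}"
    then obtain R A where x: "x = (R, A, ext I R)" and R: "sch I R = Some A" by blast
    have A: "finite A" using S R unfolding is_schema_def by blast
    have E: "finite (ext I R)" "\<And>t. t \<in> ext I R \<Longrightarrow> dom t = A"
      using T[of R] R by auto
    show "\<exists>n. codes_pair (codes_by rel_no)
        (codes_pair (codes_set (codes_by attr_no)) (codes_set codes_tuple)) x n"
      unfolding x using A E
      by (intro codes_pair_ex codes_by_ex codes_set_ex codes_tuple_ex) auto
  qed
qed

lemma codes_proc_ex: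
  assumes "wf_proc P"
  shows "\<exists>n. codes_proc P n"
  unfolding codes_proc_def using assms
  by (intro codes_pair_ex codes_set_ex codes_by_ex) (auto simp: wf_proc_def)

lemma codes_input_ex:
  assumes "x \<in> readiness_inputs"
  shows "\<exists>n. codes_input x n"
  unfolding codes_input_def using assms
  by (intro codes_pair_ex codes_set_ex codes_by_ex codes_db_ex codes_proc_ex)
     (auto simp: readiness_inputs_def)

lemma codes_by_unique: "inj e \<Longrightarrow> left_unique (codes_by e)"
  by (auto simp: left_unique_def codes_by_def inj_def)

lemma codes_pair_unique: "left_unique r \<Longrightarrow> left_unique s \<Longrightarrow> left_unique (codes_pair r s)"
  unfolding left_unique_def codes_pair_def by (metis prod.collapse)

lemma codes_set_unique: "left_unique r \<Longrightarrow> left_unique (codes_set r)"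
  using left_unique_rel_set[of r] unfolding left_unique_def codes_set_def by blast

lemma inj_nos: "inj attr_no" "inj val_no" "inj rel_no"
  by (auto simp: inj_def intro: attr.expand val.expand rel.expand)

lemma inj_enc_atom: "inj enc_atom"
proof (rule injI)
  fix a b assume ab: "enc_atom a = enc_atom b"
  have "inj (\<lambda>(A, x). prod_encode (attr_no A, x))"
    by (auto simp: inj_def intro: attr.expand)
  with ab show "a = b"
    by (cases a; cases b) (auto simp: list_encode_eq inj_map_eq_map intro: rel.expand)
qed

lemma inj_enc_atoms: "inj enc_atoms"
  using inj_enc_atom by (auto simp: inj_def[of enc_atoms] enc_atoms_def list_encode_eq inj_map_eq_map)

lemma inj_enc_cq: "inj enc_cq"
proof (rule injI)
  fix a b assume "enc_cq a = enc_cq b"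
  then show "a = b" by (cases a; cases b) (auto simp: list_encode_eq dest: injD[OF inj_enc_atoms])
qed

lemma inj_enc_tgd: "inj enc_tgd"
proof (rule injI)
  fix a b assume "enc_tgd a = enc_tgd b"
  then show "a = b" by (cases a; cases b) (auto simp: list_encode_eq dest: injD[OF inj_enc_atoms])
qed

lemma inj_enc_query: "inj enc_query"
proof (rule injI)
  fix a b assume "enc_query a = enc_query b"
  then show "a = b" by (cases a; cases b) (auto simp: sum_encode_eq dest: injD[OF inj_enc_cq] intro: rel.expand)
qed

lemma inj_enc_constr: "inj enc_constr"
proof (rule injI)
  fix a b assume "enc_constr a = enc_constr b"
  then show "a = b"
    by (cases a; cases b) (auto simp: sum_encode_eq dest: injD[OF inj_enc_cq] injD[OF inj_enc_tgd])
qed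

lemma inj_enc_sconstr: "inj enc_sconstr"
proof (rule injI)
  fix a b assume "enc_sconstr a = enc_sconstr b"
  then show "a = b"
    by (cases a; cases b) (auto simp: sum_encode_eq list_encode_eq inj_map_eq_map[OF inj_nos(1)] intro: rel.expand)
qed

lemma codes_tuple_unique: "left_unique codes_tuple"
proof (rule left_uniqueI)
  fix t u n assume "codes_tuple t n" "codes_tuple u n"
  then have g: "Map.graph t = Map.graph u"
    using codes_set_unique[OF codes_pair_unique[OF codes_by_unique codes_by_unique], OF inj_nos(1,2)]
    unfolding codes_tuple_def left_unique_def by blast
  have "t A = Some v \<longleftrightarrow> u A = Some v" for A v
    using arg_cong[OF g, of "\<lambda>X. (A, v) \<in> X"] by (simp add: Map.graph_def)
  then show "t = u" by (metis map_le_antisym map_le_def domD)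
qed

lemma codes_db_unique:
  assumes "is_instance I" "is_instance J" "codes_db I n" "codes_db J n"
  shows "I = J"
proof -
  have "left_unique (codes_set (codes_pair (codes_by rel_no)
      (codes_pair (codes_set (codes_by attr_no)) (codes_set codes_tuple))))"
    by (intro codes_set_unique codes_pair_unique codes_by_unique codes_tuple_unique inj_nos)
  then have eq: "{(R, A, ext I R) |R A. sch I R = Some A} = {(R, A, ext J R) |R A. sch J R = Some A}"
    by (rule left_uniqueD) (use assms(3,4) in \<open>simp_all only: codes_db_def\<close>)
  have e: "sch I R = Some A \<and> X = ext I R \<longleftrightarrow> sch J R = Some A \<and> X = ext J R" for R A X
    using arg_cong[OF eq, of "\<lambda>Y. (R, A, X) \<in> Y"] by (simp add: conj_commute)
  have s: "sch I R = sch J R" for R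
    using e[of R] by (metis option.exhaust)
  have "ext I R = ext J R" for R
  proof (cases "sch I R")
    case None
    moreover have "\<And>K. is_instance K \<Longrightarrow> sch K R = None \<Longrightarrow> ext K R = {}"
      unfolding is_instance_def by (drule conjunct2, drule_tac x = R in spec) simp
    ultimately show ?thesis using s[of R] assms(1,2) by simp
  next
    case (Some A)
    then show ?thesis using e[of R A "ext I R"] by blast
  qed
  with s have "sch I = sch J" "db.ext I = db.ext J" by blast+
  then show ?thesis by simp
qed

lemma codes_proc_unique: "left_unique codes_proc"
proof (rule left_uniqueI)
  fix P P' n assume "codes_proc P n" "codes_proc P' n"
  moreover have "left_unique (codes_pair (codes_set (codes_by enc_sconstr))
       (codes_pair (codes_set (codes_by enc_constr))
         (codes_pair (codes_set (codes_by enc_constr)) (codes_set (codes_by enc_query)))))"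
    by (intro codes_set_unique codes_pair_unique codes_by_unique
        inj_enc_sconstr inj_enc_constr inj_enc_query)
  ultimately have "(scope P, c_in P, c_out P, q_pres P) = (scope P', c_in P', c_out P', q_pres P')"
    unfolding codes_proc_def left_unique_def by blast
  then show "P = P'" by simp
qed

lemma codes_input_unique:
  assumes "x \<in> readiness_inputs" "y \<in> readiness_inputs" "codes_input x n" "codes_input y n"
  shows "x = y"
proof -
  have "left_unique (codes_pair (codes_set codes_proc) (codes_by enc_cq))"
    by (intro codes_set_unique codes_pair_unique codes_by_unique codes_proc_unique inj_enc_cq)
  then have "snd x = snd y"
    using assms(3,4) unfolding codes_input_def codes_pair_def[of codes_db] left_unique_def by blast
  moreover have "fst x = fst y"
    using assms codes_db_unique unfolding codes_input_def codes_pair_def[of codes_db]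
    by (auto simp: readiness_inputs_def)
  ultimately show ?thesis by (simp add: prod_eq_iff)
qed


section \<open>Decidability\<close>

text \<open>Partial recursive functions, with their graphs as evaluation relation.\<close>

datatype recf =
  Zero
| Succ
| Proj nat
| Comp recf "recf list"
| PrimRec recf recf
| Mu recf

inductive rec_eval :: "recf \<Rightarrow> nat list \<Rightarrow> nat \<Rightarrow> bool" where
  zero: "rec_eval Zero xs 0"
| succ: "rec_eval Succ [x] (Suc x)"
| proj: "i < length xs \<Longrightarrow> rec_eval (Proj i) xs (xs ! i)"
| comp: "list_all2 (\<lambda>g y. rec_eval g xs y) gs ys \<Longrightarrow> rec_eval f ys z \<Longrightarrow> rec_eval (Comp f gs) xs z"
| prim_0: "rec_eval f xs y \<Longrightarrow> rec_eval (PrimRec f g) (0 # xs) y"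
| prim_Suc: "rec_eval (PrimRec f g) (n # xs) y \<Longrightarrow> rec_eval g (n # y # xs) z \<Longrightarrow>
    rec_eval (PrimRec f g) (Suc n # xs) z"
| mu: "rec_eval f (n # xs) 0 \<Longrightarrow> (\<And>m. m < n \<Longrightarrow> \<exists>y. rec_eval f (m # xs) (Suc y)) \<Longrightarrow>
    rec_eval (Mu f) xs n"

lemma rec_eval_deterministic:
  "rec_eval f xs y \<Longrightarrow> rec_eval f xs z \<Longrightarrow> y = z"
proof (induction arbitrary: z rule: rec_eval.induct)
  case (zero xs)
  then show ?case by (auto elim: rec_eval.cases)
next
  case (succ x)
  then show ?case by (auto elim: rec_eval.cases)
next
  case (proj i xs)
  then show ?case by (auto elim: rec_eval.cases)
next
  case (comp xs gs ys f w)
  from comp.prems obtain ys' where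
    ys': "list_all2 (\<lambda>g y. rec_eval g xs y) gs ys'" "rec_eval f ys' z"
    by (cases rule: rec_eval.cases) auto
  have "ys = ys'"
    using comp.IH(1) ys'(1) by (auto simp: list_all2_conv_all_nth intro!: nth_equalityI)
  with comp.IH(2) ys'(2) show ?case by simp
next
  case (prim_0 f xs y g)
  from prim_0.prems have "rec_eval f xs z" by (cases rule: rec_eval.cases) auto
  then show ?case by (rule prim_0.IH)
next
  case (prim_Suc f g n xs y w)
  from prim_Suc.prems obtain y' where
    "rec_eval (PrimRec f g) (n # xs) y'" "rec_eval g (n # y' # xs) z"
    by (cases rule: rec_eval.cases) auto
  with prim_Suc.IH show ?case by blast
next
  case (mu f n xs)
  from mu.prems have z: "rec_eval f (z # xs) 0" "\<And>m. m < z \<Longrightarrow> \<exists>y. rec_eval f (m # xs) (Suc y)"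
    by (cases rule: rec_eval.cases; auto)+
  show ?case
  proof (rule linorder_cases[of n z])
    assume "n < z"
    with z(2) mu.IH(1) show ?thesis by blast
  next
    assume "z < n"
    with mu.IH(2) z(1) show ?thesis by blast
  qed
qed

text \<open>
  A problem with yes-instances \<open>L\<close> is decidable on the inputs in \<open>X\<close> if some partial recursive
  function answers correctly on every code of every input in \<open>X\<close>; it may behave arbitrarily,
  and need not terminate, on other numbers.
\<close>

definition decidable_on :: "('a \<Rightarrow> nat \<Rightarrow> bool) \<Rightarrow> 'a set \<Rightarrow> 'a set \<Rightarrow> bool" where
  "decidable_on code X L \<longleftrightarrow>
     (\<exists>f. \<forall>x\<in>X. \<forall>n. code x n \<longrightarrow> rec_eval f [n] (if x \<in> L then 1 else 0))"

end

theory Submission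
  imports Defs "HOL-Library.Countable"
begin

text \<open>
  Suppose that \<open>f\<close> decides the problem.  The evaluation of a partial recursive function \<open>q\<close> is a
  finite set of Horn rules over numbers, and each rule is the postcondition of one procedure with
  safe scope; numbers beyond those of the instance come from the single existential rule that
  creates successors.  All outcomes of a sequence contain what the chase along that sequence
  derives, and some outcome contains only facts that are true in the natural numbers.  So \<open>\<Pi>\<close>
  depends on \<open>q\<close> only, an instance \<open>I a b\<close> holds a pair of numbers, and readiness is equivalent
  to \<open>q (a, b) = 0\<close>.  Now let \<open>q (a, b)\<close> be \<open>f\<close> applied to the number that is composed of the
  code of the variable part of \<open>I a b\<close>, of \<open>a\<close> and of \<open>b\<close>, and choose for \<open>a\<close> a code of the
  fixed part of the instance and for \<open>b\<close> a code of the procedures and the query: \<open>f\<close> errs on this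
  input.  The diagonalisation needs no universal function.
\<close>

section \<open>Databases over coded relation symbols\<close>

instance recf :: countable
  by countable_datatype

text \<open>A subprogram serves as its own name: its relations are indexed by the term and the
  number of arguments. Countability turns these symbols into relation names.\<close>

datatype rsym = NumR | SucR | ZeroR | InR | HaltR | EvR recf nat | AuxR recf nat | StepR recf nat

instance rsym :: countable
  by countable_datatype

fun arity :: "rsym \<Rightarrow> nat" where
  "arity NumR = 1"
| "arity SucR = 2"
| "arity ZeroR = 1"
| "arity InR = 2"
| "arity HaltR = 1"
| "arity (EvR f k) = Suc k"
| "arity (AuxR f k) = Suc k"
| "arity (StepR f k) = Suc k"

definition rel_of :: "rsym \<Rightarrow> rel" where
  "rel_of s = Rel (to_nat s)"

lemma rel_of_eq [simp]: "rel_of s = rel_of s' \<longleftrightarrow> s = s'"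
  by (simp add: rel_of_def)

lemma inv_rel_of [simp]: "inv rel_of (rel_of s) = s"
  by (rule inv_f_f) (simp add: inj_def)

lemma rel_of_image [simp]: "rel_of s \<in> rel_of ` X \<longleftrightarrow> s \<in> X"
  by auto

definition attrs :: "nat \<Rightarrow> attr set" where
  "attrs n = Attr ` {..<n}"

lemma attr_in_attrs [simp]: "A \<in> attrs n \<longleftrightarrow> attr_no A < n"
  by (cases A) (auto simp: attrs_def)

lemma attrs_eq [simp]: "attrs m = attrs n \<longleftrightarrow> m = n"
proof
  assume "attrs m = attrs n"
  then have "attr_no ` attrs m = attr_no ` attrs n" by simp
  then show "m = n" by (simp add: attrs_def image_image)
qed simp

definition tup :: "nat list \<Rightarrow> tuple" where
  "tup ns A = (if attr_no A < length ns then Some (Val (ns ! attr_no A)) else None)"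

lemma dom_tup [simp]: "dom (tup ns) = attrs (length ns)"
  by (auto simp: tup_def dom_def)

lemma tup_eq [simp]: "tup ms = tup ns \<longleftrightarrow> ms = ns"
proof
  assume eq: "tup ms = tup ns"
  then have l: "length ms = length ns" by (metis dom_tup attrs_eq)
  have "ms ! i = ns ! i" if "i < length ms" for i
    using fun_cong[OF eq, of "Attr i"] that l by (simp add: tup_def)
  with l show "ms = ns" by (rule nth_equalityI)
qed simp

lemma tup_ex:
  assumes "dom t = attrs n"
  shows "\<exists>ns. length ns = n \<and> t = tup ns"
proof (intro exI conjI)
  let ?ns = "map (\<lambda>i. val_no (the (t (Attr i)))) [0..<n]"
  show "length ?ns = n" by simp
  show "t = tup ?ns"
  proof
    fix A
    show "t A = tup ?ns A"
    proof (cases "A \<in> dom t")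
      case True
      then obtain v where "t A = Some v" by blast
      then show ?thesis using True assms by (cases A) (auto simp: tup_def)
    next
      case False
      then show ?thesis using assms by (auto simp: tup_def domIff)
    qed
  qed
qed

text \<open>Total queries compare unnamed tuples. On a common finite domain the list of values
  determines the tuple, so preserving answers means preserving tuples.\<close>

lemma unnamed_inj:
  assumes "unnamed t = unnamed u" "dom t = dom u" "finite (dom t)"
  shows "t = u"
proof
  fix A
  have eq: "\<forall>A\<in>dom t. the (t A) = the (u A)"
    using assms unfolding unnamed_def by (auto simp: map_eq_conv)
  then show "t A = u A"
  proof (cases "A \<in> dom t")
    case True
    then obtain v w where "t A = Some v" "u A = Some w" using assms(2) by blast
    with eq True show ?thesis by force
  next
    case False
    moreover have "A \<notin> dom u" using False assms(2) by simp
    ultimately show ?thesis by (simp add: domIff)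
  qed
qed

section \<open>Instances as sets of number lists\<close>

definition schema_of :: "rsym set \<Rightarrow> schema" where
  "schema_of Rs R = (if R \<in> rel_of ` Rs then Some (attrs (arity (inv rel_of R))) else None)"

lemma schema_of_rel_of [simp]: "R \<in> Rs \<Longrightarrow> schema_of Rs (rel_of R) = Some (attrs (arity R))"
  by (auto simp: schema_of_def)

definition facts :: "db \<Rightarrow> rsym \<Rightarrow> nat list set" where
  "facts I R = {ns. tup ns \<in> ext I (rel_of R)}"

definition over :: "rsym set \<Rightarrow> db \<Rightarrow> bool" where
  "over Rs I \<longleftrightarrow> is_instance I \<and> sch I = schema_of Rs"

lemma over_ext_None:
  assumes "over Rs I" "R \<notin> rel_of ` Rs"
  shows "ext I R = {}"
proof -
  have "sch I R = None" using assms by (simp add: over_def schema_of_def)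
  moreover have "case sch I R of None \<Rightarrow> ext I R = {}
      | Some A \<Rightarrow> finite (ext I R) \<and> (\<forall>t\<in>ext I R. dom t = A)"
    using assms(1) unfolding over_def is_instance_def by blast
  ultimately show ?thesis by simp
qed

lemma over_ext:
  assumes "over Rs I" "R \<in> Rs"
  shows "finite (ext I (rel_of R))" "t \<in> ext I (rel_of R) \<Longrightarrow> dom t = attrs (arity R)"
proof -
  have "sch I (rel_of R) = Some (attrs (arity R))" using assms by (simp add: over_def)
  moreover have "case sch I (rel_of R) of None \<Rightarrow> ext I (rel_of R) = {}
      | Some A \<Rightarrow> finite (ext I (rel_of R)) \<and> (\<forall>t\<in>ext I (rel_of R). dom t = A)"
    using assms(1) unfolding over_def is_instance_def by blast
  ultimately have "finite (ext I (rel_of R)) \<and> (\<forall>t\<in>ext I (rel_of R). dom t = attrs (arity R))"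
    by simp
  then show "finite (ext I (rel_of R))" "t \<in> ext I (rel_of R) \<Longrightarrow> dom t = attrs (arity R)" by auto
qed

text \<open>Every tuple of the right domain is some \<open>tup ns\<close>, so an instance can be
  handled through \<open>facts\<close> from here on.\<close>

lemma over_facts:
  assumes "over Rs I" "R \<in> Rs"
  shows "ext I (rel_of R) = tup ` facts I R" "finite (facts I R)"
    "ns \<in> facts I R \<Longrightarrow> length ns = arity R"
proof -
  show e: "ext I (rel_of R) = tup ` facts I R"
  proof (intro equalityI subsetI)
    fix t assume t: "t \<in> ext I (rel_of R)"
    then obtain ns where "t = tup ns" using over_ext(2)[OF assms] tup_ex by blast
    with t show "t \<in> tup ` facts I R" by (simp add: facts_def)
  qed (auto simp: facts_def)
  have "inj_on tup (facts I R)" by (simp add: inj_on_def)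
  with e over_ext(1)[OF assms] show "finite (facts I R)"
    by (metis finite_imageD)
  assume "ns \<in> facts I R"
  then show "length ns = arity R"
    using over_ext(2)[OF assms, of "tup ns"] by (simp add: facts_def)
qed

lemma over_facts_empty: "over Rs I \<Longrightarrow> R \<notin> Rs \<Longrightarrow> facts I R = {}"
  using over_ext_None[of Rs I "rel_of R"] by (simp add: facts_def)

definition db_of :: "rsym set \<Rightarrow> (rsym \<Rightarrow> nat list set) \<Rightarrow> db" where
  "db_of Rs E = \<lparr>sch = schema_of Rs, ext = (\<lambda>R. if R \<in> rel_of ` Rs then tup ` E (inv rel_of R) else {})\<rparr>"

lemma facts_db_of [simp]: "R \<in> Rs \<Longrightarrow> facts (db_of Rs E) R = E R"
  by (auto simp: facts_def db_of_def)

lemma over_db_of: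
  assumes "finite Rs" "\<And>R. R \<in> Rs \<Longrightarrow> finite (E R)"
    "\<And>R ns. R \<in> Rs \<Longrightarrow> ns \<in> E R \<Longrightarrow> length ns = arity R"
  shows "over Rs (db_of Rs E)"
proof -
  have "dom (schema_of Rs) = rel_of ` Rs"
    by (auto simp: dom_def schema_of_def)
  then have "is_schema (schema_of Rs)"
    using assms(1) by (auto simp: is_schema_def schema_of_def attrs_def split: if_splits)
  then show ?thesis
    using assms(2,3) by (simp add: over_def is_instance_def db_of_def schema_of_def) auto
qed


section \<open>Horn rules as procedures\<close>

type_synonym patom = "rsym \<times> nat list"
type_synonym rule = "patom list \<times> patom"

fun atom_of :: "patom \<Rightarrow> atom" where
  "atom_of (R, vs) = Atom (rel_of R) (zip (map Attr [0..<length vs]) vs)"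

definition body_vars :: "patom list \<Rightarrow> nat set" where
  "body_vars B = (\<Union>p\<in>set B. set (snd p))"

text \<open>All variables of the body are universal; the existential ones are those that occur in
  the head only.\<close>

fun tgd_of :: "rule \<Rightarrow> tgd" where
  "tgd_of (B, H) = TGD (concat (map snd B)) (map atom_of B) [atom_of H]"

fun proc_of :: "rule \<Rightarrow> proc" where
  "proc_of (B, H) = \<lparr>scope = {Star (rel_of (fst H))}, c_in = {}, c_out = {Dep (tgd_of (B, H))},
     q_pres = {Total (rel_of (fst H))}\<rparr>"

text \<open>A well-formed conjunction is nonempty, and the head relation stays out of the body so
  that the single tgd is acyclic.\<close>

definition ok_rule :: "rule \<Rightarrow> bool" where
  "ok_rule r \<longleftrightarrow> fst r \<noteq> [] \<and> fst (snd r) \<notin> fst ` set (fst r) \<and>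
     (\<forall>p\<in>insert (snd r) (set (fst r)). length (snd p) = arity (fst p))"

definition rule_rels :: "rule \<Rightarrow> rsym set" where
  "rule_rels r = fst ` insert (snd r) (set (fst r))"

definition match :: "(rsym \<Rightarrow> nat list set) \<Rightarrow> (nat \<Rightarrow> nat) \<Rightarrow> patom list \<Rightarrow> bool" where
  "match E \<sigma> B \<longleftrightarrow> (\<forall>p\<in>set B. map \<sigma> (snd p) \<in> E (fst p))"

lemma match_simps [simp]:
  "match E \<sigma> []"
  "match E \<sigma> (p # B) \<longleftrightarrow> map \<sigma> (snd p) \<in> E (fst p) \<and> match E \<sigma> B"
  "match E \<sigma> (B @ B') \<longleftrightarrow> match E \<sigma> B \<and> match E \<sigma> B'"
  by (auto simp: match_def)

lemma set_zip_attrs: "(A, x) \<in> set (zip (map Attr [0..<length vs]) vs) \<longleftrightarrow>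
    attr_no A < length vs \<and> x = vs ! attr_no A"
  by (cases A) (force simp: set_zip)

lemma wf_atom_of: "wf_atom (atom_of p)"
  by (cases p) (auto simp: wf_atom_def distinct_map inj_on_def)

lemma atom_rel_of [simp]: "atom_rel (atom_of p) = rel_of (fst p)"
  by (cases p) simp

lemma snd_args_of: "snd ` set (atom_args (atom_of p)) = set (snd p)"
proof (cases p)
  case (Pair R vs)
  have "map snd (zip (map Attr [0..<length vs]) vs) = vs" by simp
  then show ?thesis using Pair by (simp flip: set_map)
qed

lemma fst_args_of: "fst ` set (atom_args (atom_of p)) = attrs (length (snd p))"
proof (cases p)
  case (Pair R vs)
  have "map fst (zip (map Attr [0..<length vs]) vs) = map Attr [0..<length vs]" by simp
  from arg_cong[OF this, of set] show ?thesis
    by (simp only: set_map set_upt Pair atom_of.simps atom.sel attrs_def lessThan_atLeast0 snd_conv)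
qed

lemma atoms_vars_of: "atoms_vars (map atom_of B) = body_vars B"
  by (simp add: atoms_vars_def body_vars_def snd_args_of)

lemma compatible_atoms_of:
  assumes "\<forall>p\<in>set B. length (snd p) = arity (fst p) \<and> fst p \<in> Rs"
  shows "compatible_atoms (map atom_of B) (schema_of Rs)"
  using assms by (simp add: compatible_atoms_def fst_args_of)

lemma sat_atom_of:
  assumes "over Rs I" "fst p \<in> Rs" "length (snd p) = arity (fst p)"
  shows "sat_atom I \<tau> (atom_of p) \<longleftrightarrow> map (\<lambda>x. val_no (\<tau> x)) (snd p) \<in> facts I (fst p)"
proof (cases p)
  case (Pair R vs)
  have "sat_atom I \<tau> (atom_of p) \<longleftrightarrow>
      (\<exists>ns\<in>facts I R. \<forall>A. attr_no A < length vs \<longrightarrow> tup ns A = Some (\<tau> (vs ! attr_no A)))"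
  proof -
    have "(\<forall>(A, x)\<in>set (zip (map Attr [0..<length vs]) vs). t A = Some (\<tau> x)) \<longleftrightarrow>
        (\<forall>A. attr_no A < length vs \<longrightarrow> t A = Some (\<tau> (vs ! attr_no A)))" for t :: tuple
      unfolding Ball_def split_paired_All by (simp add: set_zip_attrs)
    then show ?thesis
      using over_facts(1)[OF assms(1,2)] Pair by (simp add: sat_atom_def)
  qed
  also have "\<dots> \<longleftrightarrow> (\<exists>ns\<in>facts I R. ns = map (\<lambda>x. val_no (\<tau> x)) vs)"
  proof (rule bex_cong[OF refl])
    fix ns assume "ns \<in> facts I R"
    then have l: "length ns = length vs"
      using over_facts(3)[OF assms(1,2)] assms(3) Pair by simp
    show "(\<forall>A. attr_no A < length vs \<longrightarrow> tup ns A = Some (\<tau> (vs ! attr_no A))) \<longleftrightarrow>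
        ns = map (\<lambda>x. val_no (\<tau> x)) vs" (is "?L \<longleftrightarrow> ?R")
    proof
      assume L: ?L
      show ?R
      proof (rule nth_equalityI)
        fix i assume "i < length ns"
        then show "ns ! i = map (\<lambda>x. val_no (\<tau> x)) vs ! i"
          using L[rule_format, of "Attr i"] l by (simp add: tup_def) (metis val.sel)
      qed (simp add: l)
    qed (auto simp: tup_def)
  qed
  finally show ?thesis using Pair by auto
qed

lemma sat_atoms_of:
  assumes "over Rs I" "\<forall>p\<in>set B. length (snd p) = arity (fst p) \<and> fst p \<in> Rs"
  shows "sat_atoms I \<tau> (map atom_of B) \<longleftrightarrow> match (facts I) (\<lambda>x. val_no (\<tau> x)) B"
  using assms by (simp add: sat_atoms_def match_def sat_atom_of)

lemma tgd_holds_of: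
  assumes I: "over Rs I" and ok: "ok_rule (B, H)" and rels: "rule_rels (B, H) \<subseteq> Rs"
  shows "tgd_holds I (tgd_of (B, H)) \<longleftrightarrow> (\<forall>\<sigma>. match (facts I) \<sigma> B \<longrightarrow>
     (\<exists>\<sigma>'. (\<forall>x\<in>body_vars B. \<sigma>' x = \<sigma> x) \<and> match (facts I) \<sigma>' [H]))"
proof -
  have B: "\<forall>p\<in>set B. length (snd p) = arity (fst p) \<and> fst p \<in> Rs"
    and H: "\<forall>p\<in>set [H]. length (snd p) = arity (fst p) \<and> fst p \<in> Rs"
    using ok rels by (auto simp: ok_rule_def rule_rels_def)
  have vars: "set (concat (map snd B)) = body_vars B"
    by (simp add: body_vars_def)
  have sB: "sat_atoms I \<tau> (map atom_of B) \<longleftrightarrow> match (facts I) (\<lambda>x. val_no (\<tau> x)) B" for \<tau>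
    by (rule sat_atoms_of[OF I B])
  have sH: "sat_atoms I \<tau> [atom_of H] \<longleftrightarrow> match (facts I) (\<lambda>x. val_no (\<tau> x)) [H]" for \<tau>
    using sat_atoms_of[OF I H] by simp
  show ?thesis
    unfolding tgd_holds_def tgd_of.simps tgd.sel vars sB sH
  proof (intro iffI allI impI)
    fix \<sigma>
    assume a: "\<forall>\<tau>. (\<exists>\<tau>'. (\<forall>x\<in>body_vars B. \<tau>' x = \<tau> x) \<and> match (facts I) (\<lambda>x. val_no (\<tau>' x)) B) \<longrightarrow>
        (\<exists>\<tau>'. (\<forall>x\<in>body_vars B. \<tau>' x = \<tau> x) \<and> match (facts I) (\<lambda>x. val_no (\<tau>' x)) [H])"
      and m: "match (facts I) \<sigma> B"
    have "\<exists>\<tau>'. (\<forall>x\<in>body_vars B. \<tau>' x = Val (\<sigma> x)) \<and> match (facts I) (\<lambda>x. val_no (\<tau>' x)) B"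
      by (rule exI[of _ "\<lambda>x. Val (\<sigma> x)"]) (simp add: m)
    from a[THEN spec, THEN mp, OF this] obtain \<tau>' where t: "\<forall>x\<in>body_vars B. \<tau>' x = Val (\<sigma> x)"
      "match (facts I) (\<lambda>x. val_no (\<tau>' x)) [H]"
      by (elim exE conjE) (rule that)
    then show "\<exists>\<sigma>'. (\<forall>x\<in>body_vars B. \<sigma>' x = \<sigma> x) \<and> match (facts I) \<sigma>' [H]"
      by (intro exI[of _ "\<lambda>x. val_no (\<tau>' x)"]) simp
  next
    fix \<tau>
    assume a: "\<forall>\<sigma>. match (facts I) \<sigma> B \<longrightarrow>
        (\<exists>\<sigma>'. (\<forall>x\<in>body_vars B. \<sigma>' x = \<sigma> x) \<and> match (facts I) \<sigma>' [H])"
      and "\<exists>\<tau>'. (\<forall>x\<in>body_vars B. \<tau>' x = \<tau> x) \<and> match (facts I) (\<lambda>x. val_no (\<tau>' x)) B"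
    then obtain \<tau>' where t: "\<forall>x\<in>body_vars B. \<tau>' x = \<tau> x" "match (facts I) (\<lambda>x. val_no (\<tau>' x)) B"
      by blast
    obtain \<sigma>' where s: "\<forall>x\<in>body_vars B. \<sigma>' x = val_no (\<tau>' x)" "match (facts I) \<sigma>' [H]"
      using a[THEN spec, THEN mp, OF t(2)] by (elim exE conjE) (rule that)
    have "\<forall>x\<in>body_vars B. Val (\<sigma>' x) = \<tau> x"
      using s(1) t(1) by simp
    with s(2) show "\<exists>\<tau>'. (\<forall>x\<in>body_vars B. \<tau>' x = \<tau> x) \<and> match (facts I) (\<lambda>x. val_no (\<tau>' x)) [H]"
      by (intro exI[of _ "\<lambda>x. Val (\<sigma>' x)"]) simp
  qed
qed

section \<open>The outcomes of a single rule\<close>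

text \<open>The definition of \<open>outcomes\<close> is unfolded only here. A procedure may add
  arbitrary facts to its head relation, as long as the rule holds afterwards.\<close>

lemma outcomes_proc_of:
  assumes I: "over Rs I" and ok: "ok_rule (B, H)" and rels: "rule_rels (B, H) \<subseteq> Rs"
  shows "I' \<in> outcomes (proc_of (B, H)) I \<longleftrightarrow> over Rs I' \<and>
     (\<forall>R. R \<noteq> fst H \<longrightarrow> facts I' R = facts I R) \<and> facts I (fst H) \<subseteq> facts I' (fst H) \<and>
     (\<forall>\<sigma>. match (facts I') \<sigma> B \<longrightarrow>
       (\<exists>\<sigma>'. (\<forall>x\<in>body_vars B. \<sigma>' x = \<sigma> x) \<and> match (facts I') \<sigma>' [H]))"
proof (cases "over Rs I'")
  case False
  then show ?thesis using I by (auto simp: outcomes_def over_def)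
next
  case I': True
  have HRs: "fst H \<in> Rs" using rels by (simp add: rule_rels_def)
  have ok': "\<forall>p\<in>set B. length (snd p) = arity (fst p) \<and> fst p \<in> Rs"
    "\<forall>p\<in>set [H]. length (snd p) = arity (fst p) \<and> fst p \<in> Rs"
    using ok rels by (auto simp: ok_rule_def rule_rels_def)
  have sch: "sch I = schema_of Rs" "sch I' = schema_of Rs" "is_instance I'"
    using I I' by (auto simp: over_def)
  have c: "sat_constrs I' {Dep (tgd_of (B, H))} \<longleftrightarrow> tgd_holds I' (tgd_of (B, H))"
    using compatible_atoms_of[OF ok'(1)] compatible_atoms_of[OF ok'(2)]
    by (simp add: sat_constrs_def sch)
  have app: "applicable (proc_of (B, H)) I"
    using HRs by (simp add: applicable_def sat_constrs_def sch dom_def)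
  have agree: "agree_outside {Star (rel_of (fst H))} I I' \<longleftrightarrow> (\<forall>R. R \<noteq> fst H \<longrightarrow> facts I' R = facts I R)"
  proof -
    have "agree_outside {Star (rel_of (fst H))} I I' \<longleftrightarrow>
        (\<forall>R\<in>Rs. R \<noteq> fst H \<longrightarrow> ext I (rel_of R) = ext I' (rel_of R))"
      unfolding agree_outside_def sch by (auto simp: schema_of_def scope_rels_def)
    also have "\<dots> \<longleftrightarrow> (\<forall>R\<in>Rs. R \<noteq> fst H \<longrightarrow> facts I' R = facts I R)"
    proof -
      have "ext I (rel_of R) = ext I' (rel_of R) \<longleftrightarrow> facts I' R = facts I R" if "R \<in> Rs" for R
        using over_facts(1)[OF I that] over_facts(1)[OF I' that] by (metis facts_def)
      then show ?thesis by simp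
    qed
    \<comment> \<open>Symbols outside \<open>Rs\<close> have no facts in either instance.\<close>
    also have "\<dots> \<longleftrightarrow> (\<forall>R. R \<noteq> fst H \<longrightarrow> facts I' R = facts I R)"
      using over_facts_empty[OF I] over_facts_empty[OF I'] by metis
    finally show ?thesis .
  qed
  have pres: "unnamed ` ext I (rel_of (fst H)) \<subseteq> unnamed ` ext I' (rel_of (fst H)) \<longleftrightarrow>
      facts I (fst H) \<subseteq> facts I' (fst H)"
  proof
    assume a: "unnamed ` ext I (rel_of (fst H)) \<subseteq> unnamed ` ext I' (rel_of (fst H))"
    show "facts I (fst H) \<subseteq> facts I' (fst H)"
    proof
      fix ns assume "ns \<in> facts I (fst H)"
      then have t: "tup ns \<in> ext I (rel_of (fst H))" by (simp add: facts_def)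
      with a obtain u where u: "u \<in> ext I' (rel_of (fst H))" "unnamed (tup ns) = unnamed u" by blast
      have "dom (tup ns) = attrs (arity (fst H))" "dom u = attrs (arity (fst H))"
        using over_ext(2)[OF I HRs t] over_ext(2)[OF I' HRs u(1)] by auto
      then have "tup ns = u"
        using u(2) by (intro unnamed_inj) (auto simp: attrs_def)
      with u(1) show "ns \<in> facts I' (fst H)" by (simp add: facts_def)
    qed
  next
    assume "facts I (fst H) \<subseteq> facts I' (fst H)"
    then show "unnamed ` ext I (rel_of (fst H)) \<subseteq> unnamed ` ext I' (rel_of (fst H))"
      using over_facts(1)[OF I HRs] over_facts(1)[OF I' HRs] by auto
  qed
  have "I' \<in> outcomes (proc_of (B, H)) I \<longleftrightarrow>
      tgd_holds I' (tgd_of (B, H)) \<and> agree_outside {Star (rel_of (fst H))} I I' \<and>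
      unnamed ` ext I (rel_of (fst H)) \<subseteq> unnamed ` ext I' (rel_of (fst H))"
    using app c sch by (simp add: outcomes_def)
  then show ?thesis
    unfolding agree pres tgd_holds_of[OF I' ok rels] using I' by blast
qed

lemma wf_proc_of:
  assumes "ok_rule r"
  shows "wf_proc (proc_of r)"
proof -
  obtain B H where r: "r = (B, H)" by (cases r)
  have "B \<noteq> []" using assms by (simp add: ok_rule_def r)
  then show ?thesis
    using wf_atom_of[of H]
    by (simp add: r wf_proc_def wf_tgd_def wf_conj_def wf_atom_of atoms_vars_of body_vars_def)
qed

text \<open>A cycle would have to enter \<open>y\<close> and leave it again, but no edge starts in
  \<open>y\<close>.\<close>

lemma acyclic_to_fresh: "y \<notin> X \<Longrightarrow> acyclic (X \<times> {y})"
proof (rule acyclicI, intro allI notI)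
  fix x assume y: "y \<notin> X" and "(x, x) \<in> (X \<times> {y})\<^sup>+"
  then obtain z where "(x, z) \<in> X \<times> {y}" and "(x, x) \<in> (X \<times> {y})\<^sup>+" by (meson tranclD)
  then have "x \<in> X" "x = y" by (auto elim: tranclE)
  with y show False by simp
qed

lemma safe_scope_proc_of:
  assumes "ok_rule r"
  shows "safe_scope (proc_of r)"
proof -
  obtain B H where r: "r = (B, H)" by (cases r)
  have "tgd_edges {tgd_of (B, H)} = (rel_of ` fst ` set B) \<times> {rel_of (fst H)}"
    by (simp add: tgd_edges_def image_image)
  moreover have "rel_of (fst H) \<notin> rel_of ` fst ` set B"
    using assms by (simp add: ok_rule_def r)
  ultimately have "acyclic (tgd_edges {tgd_of (B, H)})"
    by (simp add: acyclic_to_fresh)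
  then show ?thesis
    unfolding safe_scope_def r
    by (intro conjI exI[of _ "{tgd_of (B, H)}"]) auto
qed


declare proc_of.simps [simp del]

section \<open>Soundness and completeness of sequences of rules\<close>

lemma outcomes_seq_Nil [simp]: "outcomes_seq [] I = {I}"
  by (simp add: outcomes_seq_def)

text \<open>\<open>outcomes_set\<close> works instance by instance, so folding commutes with unions.
  This allows a sequence to be cut at any intermediate instance.\<close>

lemma fold_outcomes_UN:
  "fold outcomes_set Ps (\<Union>i\<in>A. f i) = (\<Union>i\<in>A. fold outcomes_set Ps (f i))"
proof (induction Ps arbitrary: f)
  case (Cons P Ps)
  have "outcomes_set P (\<Union>i\<in>A. f i) = (\<Union>i\<in>A. outcomes_set P (f i))"
    by (auto simp: outcomes_set_def)
  then show ?case by (simp only: fold_simps Cons.IH)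
qed simp

lemma fold_outcomes_set: "fold outcomes_set Ps X = (\<Union>I\<in>X. outcomes_seq Ps I)"
  using fold_outcomes_UN[of Ps "\<lambda>I. {I}" X] by (simp add: outcomes_seq_def)

lemma outcomes_seq_append [simp]:
  "outcomes_seq (Ps @ Qs) I = (\<Union>J\<in>outcomes_seq Ps I. outcomes_seq Qs J)"
proof -
  have "outcomes_seq (Ps @ Qs) I = fold outcomes_set Qs (outcomes_seq Ps I)"
    unfolding outcomes_seq_def fold_append by simp
  then show ?thesis by (simp add: fold_outcomes_set)
qed

lemma outcomes_seq_Cons [simp]:
  "outcomes_seq (P # Ps) I = (\<Union>J\<in>outcomes P I. outcomes_seq Ps J)"
proof -
  have "outcomes_seq (P # Ps) I = fold outcomes_set Ps (outcomes P I)"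
    unfolding outcomes_seq_def fold_simps by (simp add: outcomes_set_def)
  then show ?thesis by (simp add: fold_outcomes_set)
qed

text \<open>The bound keeps the outcome finite: a new value exceeds the old ones by one at most.\<close>

definition sound_rule :: "(rsym \<Rightarrow> nat list set) \<Rightarrow> rule \<Rightarrow> bool" where
  "sound_rule M r \<longleftrightarrow> (\<forall>\<sigma> b. match M \<sigma> (fst r) \<and> (\<forall>x\<in>body_vars (fst r). \<sigma> x \<le> b) \<longrightarrow>
     (\<exists>\<sigma>'. (\<forall>x\<in>body_vars (fst r). \<sigma>' x = \<sigma> x) \<and> match M \<sigma>' [snd r] \<and>
       (\<forall>x\<in>set (snd (snd r)). \<sigma>' x \<le> Suc b)))"

locale program =
  fixes Rs :: "rsym set" and Rules :: "rule set" and ins :: "nat list"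
  assumes finite_rels: "finite Rs"
    and ok_rules: "r \<in> Rules \<Longrightarrow> ok_rule r"
    and rels_rules: "r \<in> Rules \<Longrightarrow> rule_rels r \<subseteq> Rs"
begin

lemmas outcomes_rule = outcomes_proc_of[OF _ ok_rules rels_rules]

lemma outcomes_mono:
  assumes "over Rs I" "r \<in> Rules" "I' \<in> outcomes (proc_of r) I"
  shows "over Rs I'" "facts I R \<subseteq> facts I' R"
proof -
  obtain B H where r: "r = (B, H)" by (cases r)
  show "over Rs I'" "facts I R \<subseteq> facts I' R"
    using assms outcomes_rule[OF assms(1), of B H] unfolding r by (cases "R = fst H"; auto)+
qed

lemma outcomes_seq_mono:
  assumes "over Rs I" "set Ps \<subseteq> proc_of ` Rules" "I' \<in> outcomes_seq Ps I"
  shows "over Rs I' \<and> (\<forall>R. facts I R \<subseteq> facts I' R)"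
  using assms
proof (induction Ps arbitrary: I)
  case (Cons P Ps)
  then obtain r J where r: "P = proc_of r" "r \<in> Rules" and J: "J \<in> outcomes P I" "I' \<in> outcomes_seq Ps J"
    by auto
  have "over Rs J" "\<And>R. facts I R \<subseteq> facts J R"
    using outcomes_mono[OF Cons.prems(1) r(2)] J(1) r(1) by auto
  with Cons.IH[of J] Cons.prems(2) J(2) show ?case by fastforce
qed simp

lemma match_mono: "match E \<sigma> B \<Longrightarrow> (\<And>R. E R \<subseteq> E' R) \<Longrightarrow> match E' \<sigma> B"
  unfolding match_def by blast

text \<open>The match persists because facts only grow, and the postcondition, which is read in the
  outcome, then yields the head.\<close>

lemma fire:
  assumes I: "over Rs I" and r: "(B, R, vs) \<in> Rules" and I': "I' \<in> outcomes (proc_of (B, R, vs)) I"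
    and m: "match (facts I) \<sigma> B"
  shows "\<exists>\<sigma>'. (\<forall>x\<in>body_vars B. \<sigma>' x = \<sigma> x) \<and> map \<sigma>' vs \<in> facts I' R"
proof -
  have m': "match (facts I') \<sigma> B"
    using m by (rule match_mono) (rule outcomes_mono(2)[OF I r I'])
  have "\<forall>\<sigma>. match (facts I') \<sigma> B \<longrightarrow>
      (\<exists>\<sigma>'. (\<forall>x\<in>body_vars B. \<sigma>' x = \<sigma> x) \<and> match (facts I') \<sigma>' [(R, vs)])"
    using I' unfolding outcomes_rule[OF I r r] by (elim conjE)
  from this[THEN spec, THEN mp, OF m'] show ?thesis by simp
qed

text \<open>The witness adds to the head relation all facts of \<open>M\<close> with values up to
  \<open>Suc b\<close>, where \<open>b\<close> bounds the values of \<open>I\<close>. These are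
  finitely many, and by \<open>sound_rule\<close> they include the heads that the rule asks
  for.\<close>

lemma sound_outcome:
  assumes I: "over Rs I" and r: "r \<in> Rules" and M: "sound_rule M r" and IM: "\<And>R. facts I R \<subseteq> M R"
  shows "\<exists>I'\<in>outcomes (proc_of r) I. \<forall>R. facts I' R \<subseteq> M R"
proof -
  obtain B h vs where r': "r = (B, h, vs)" by (cases r)
  have h: "h \<in> Rs" "\<And>p. p \<in> set B \<Longrightarrow> fst p \<noteq> h" "length vs = arity h"
    using ok_rules[OF r] rels_rules[OF r] by (auto simp: r' ok_rule_def rule_rels_def)
  have "finite (\<Union>R\<in>Rs. \<Union>ns\<in>facts I R. set ns)"
    using finite_rels over_facts(2)[OF I] by blast
  then obtain b where b: "\<forall>x\<in>(\<Union>R\<in>Rs. \<Union>ns\<in>facts I R. set ns). x \<le> b"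
    using finite_nat_set_iff_bounded_le by metis
  have b': "x \<le> b" if "ns \<in> facts I R" "x \<in> set ns" for R ns x
    using b that over_facts_empty[OF I, of R] by fastforce
  define E where "E = (facts I)(h := facts I h \<union> {ns. set ns \<subseteq> {..Suc b} \<and> length ns = arity h} \<inter> M h)"
  have over: "over Rs (db_of Rs E)"
  proof (rule over_db_of[OF finite_rels])
    fix R assume "R \<in> Rs"
    then show "finite (E R)"
      using over_facts(2)[OF I] finite_lists_length_eq[of "{..Suc b}" "arity h"] by (auto simp: E_def)
  next
    fix R ns assume "R \<in> Rs" "ns \<in> E R"
    then show "length ns = arity R"
      using over_facts(3)[OF I] by (auto simp: E_def split: if_splits)
  qed
  have f: "facts (db_of Rs E) = E"
  proof
    fix R show "facts (db_of Rs E) R = E R"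
      using over_facts_empty[OF I] over_facts_empty[OF over] h(1)
      by (cases "R \<in> Rs") (auto simp: E_def)
  qed
  have "db_of Rs E \<in> outcomes (proc_of r) I"
    unfolding r'
  proof (subst outcomes_rule[OF I])
    have "\<exists>\<sigma>'. (\<forall>x\<in>body_vars B. \<sigma>' x = \<sigma> x) \<and> match E \<sigma>' [(h, vs)]" if m: "match E \<sigma> B" for \<sigma>
    proof -
      \<comment> \<open>The head relation does not occur in the body, so the added facts create no
        new match and the bound \<open>b\<close> still applies.\<close>
      have mI: "match (facts I) \<sigma> B" using m h(2) by (auto simp: match_def E_def)
      then have "match M \<sigma> B" using IM by (rule match_mono)
      moreover have "\<forall>x\<in>body_vars B. \<sigma> x \<le> b"
        using mI b' by (fastforce simp: body_vars_def match_def)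
      ultimately obtain \<sigma>' where "\<forall>x\<in>body_vars B. \<sigma>' x = \<sigma> x" "match M \<sigma>' [(h, vs)]"
        "\<forall>x\<in>set vs. \<sigma>' x \<le> Suc b"
        using M unfolding sound_rule_def r' by force
      then show ?thesis using h(3) by (intro exI[of _ \<sigma>']) (auto simp: E_def)
    qed
    then show "over Rs (db_of Rs E) \<and>
        (\<forall>R. R \<noteq> fst (h, vs) \<longrightarrow> facts (db_of Rs E) R = facts I R) \<and>
        facts I (fst (h, vs)) \<subseteq> facts (db_of Rs E) (fst (h, vs)) \<and>
        (\<forall>\<sigma>. match (facts (db_of Rs E)) \<sigma> B \<longrightarrow>
           (\<exists>\<sigma>'. (\<forall>x\<in>body_vars B. \<sigma>' x = \<sigma> x) \<and> match (facts (db_of Rs E)) \<sigma>' [(h, vs)]))"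
      using over unfolding f by (auto simp: E_def)
  qed (use r r' in auto)
  moreover have "E R \<subseteq> M R" for R using IM by (auto simp: E_def)
  ultimately show ?thesis using f by (intro bexI[of _ "db_of Rs E"]) simp_all
qed

lemma sound_outcome_seq:
  assumes "over Rs I" "\<And>r. r \<in> Rules \<Longrightarrow> sound_rule M r" "set Ps \<subseteq> proc_of ` Rules"
    "\<And>R. facts I R \<subseteq> M R"
  shows "\<exists>I'\<in>outcomes_seq Ps I. over Rs I' \<and> (\<forall>R. facts I' R \<subseteq> M R)"
  using assms(1,3,4)
proof (induction Ps arbitrary: I)
  case (Cons P Ps)
  then obtain r where r: "P = proc_of r" "r \<in> Rules" by auto
  obtain J where J: "J \<in> outcomes P I" "\<And>R. facts J R \<subseteq> M R"
    using sound_outcome[OF Cons.prems(1) r(2) assms(2)[OF r(2)] Cons.prems(3)] r(1) by blast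
  have "over Rs J" using outcomes_mono(1)[OF Cons.prems(1) r(2)] J(1) r(1) by simp
  with Cons.IH[of J] Cons.prems(2) J show ?case by auto
qed simp

section \<open>Facts that can be forced along a successor chain\<close>

text \<open>
  The values of an outcome are arbitrary, so numbers are read off along a successor chain \<open>\<nu>\<close>.
\<close>

definition chain :: "(nat \<Rightarrow> nat) \<Rightarrow> nat \<Rightarrow> db \<Rightarrow> bool" where
  "chain \<nu> n I \<longleftrightarrow> over Rs I \<and> [\<nu> 0] \<in> facts I ZeroR \<and> map \<nu> ins \<in> facts I InR \<and>
     (\<forall>i<n. [\<nu> i, \<nu> (Suc i)] \<in> facts I SucR)"

text \<open>The numbers in \<open>Fs\<close> are positions on the chain, which \<open>\<nu>\<close>
  turns into values. Length and sequence are fixed before instance and chain, since one plan must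
  work for all intermediate outcomes.\<close>

definition forced :: "patom list \<Rightarrow> bool" where
  "forced Fs \<longleftrightarrow> (\<exists>n Ps. set Ps \<subseteq> proc_of ` Rules \<and>
     (\<forall>\<nu> I. chain \<nu> n I \<longrightarrow> (\<forall>I'\<in>outcomes_seq Ps I. match (facts I') \<nu> Fs)))"

lemma chain_outcome:
  assumes "chain \<nu> n I" "set Ps \<subseteq> proc_of ` Rules" "I' \<in> outcomes_seq Ps I"
  shows "chain \<nu> n I'"
  using assms outcomes_seq_mono[of I Ps I'] unfolding chain_def by blast

lemma chain_le: "chain \<nu> n I \<Longrightarrow> m \<le> n \<Longrightarrow> chain \<nu> m I"
  by (auto simp: chain_def)

text \<open>The chain and the facts forced so far survive further procedures, so the two sequences
  can be run one after the other.\<close>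

lemma forced_append:
  assumes "forced Fs" "forced Gs"
  shows "forced (Fs @ Gs)"
proof -
  obtain m Ps where P: "set Ps \<subseteq> proc_of ` Rules"
    "\<And>\<nu> I I'. chain \<nu> m I \<Longrightarrow> I' \<in> outcomes_seq Ps I \<Longrightarrow> match (facts I') \<nu> Fs"
    using assms(1) unfolding forced_def by blast
  obtain n Qs where Q: "set Qs \<subseteq> proc_of ` Rules"
    "\<And>\<nu> I I'. chain \<nu> n I \<Longrightarrow> I' \<in> outcomes_seq Qs I \<Longrightarrow> match (facts I') \<nu> Gs"
    using assms(2) unfolding forced_def by blast
  have "match (facts I') \<nu> (Fs @ Gs)" if c: "chain \<nu> (max m n) I" and I': "I' \<in> outcomes_seq (Ps @ Qs) I" for \<nu> I I'
  proof -
    obtain J where J: "J \<in> outcomes_seq Ps I" "I' \<in> outcomes_seq Qs J" using I' by auto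
    have cJ: "chain \<nu> (max m n) J" using chain_outcome[OF c P(1) J(1)] .
    have "match (facts J) \<nu> Fs" using P(2)[OF chain_le[OF c] J(1)] by simp
    moreover have "facts J R \<subseteq> facts I' R" for R
      using outcomes_seq_mono[OF _ Q(1) J(2)] cJ by (simp add: chain_def)
    ultimately have "match (facts I') \<nu> Fs" by (rule match_mono)
    moreover have "match (facts I') \<nu> Gs" using Q(2)[OF chain_le[OF cJ] J(2)] by simp
    ultimately show ?thesis by simp
  qed
  then show ?thesis
    unfolding forced_def using P(1) Q(1) by (intro exI[of _ "max m n"] exI[of _ "Ps @ Qs"]) auto
qed

lemma forced_list: "(\<And>p. p \<in> set Fs \<Longrightarrow> forced [p]) \<Longrightarrow> forced Fs"
proof (induction Fs)
  case Nil
  show ?case unfolding forced_def by (intro exI[of _ 0] exI[of _ "[]"]) simp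
next
  case (Cons p Fs)
  then show ?case using forced_append[of "[p]" Fs] by simp
qed

lemma match_map: "match E \<nu> (map (\<lambda>p. (fst p, map \<sigma> (snd p))) B) \<longleftrightarrow> match E (\<nu> \<circ> \<sigma>) B"
  by (simp add: match_def)

text \<open>A derivation step: after a sequence that forces the body, the procedure of the rule is
  appended. No head variable is existential, so the assignment obtained from \<open>fire\<close>
  agrees with \<open>\<nu> \<circ> \<sigma>\<close> on the head.\<close>

lemma forced_rule:
  assumes r: "(B, R, vs) \<in> Rules" and vs: "set vs \<subseteq> body_vars B"
    and B: "\<And>p. p \<in> set B \<Longrightarrow> forced [(fst p, map \<sigma> (snd p))]"
  shows "forced [(R, map \<sigma> vs)]"
proof -
  have "forced (map (\<lambda>p. (fst p, map \<sigma> (snd p))) B)"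
    by (rule forced_list) (use B in auto)
  then obtain n Ps where P: "set Ps \<subseteq> proc_of ` Rules"
    "\<And>\<nu> I I'. chain \<nu> n I \<Longrightarrow> I' \<in> outcomes_seq Ps I \<Longrightarrow> match (facts I') (\<nu> \<circ> \<sigma>) B"
    unfolding forced_def match_map by blast
  have "match (facts I') \<nu> [(R, map \<sigma> vs)]"
    if c: "chain \<nu> n I" and I': "I' \<in> outcomes_seq (Ps @ [proc_of (B, R, vs)]) I" for \<nu> I I'
  proof -
    obtain J where J: "J \<in> outcomes_seq Ps I" "I' \<in> outcomes (proc_of (B, R, vs)) J" using I' by auto
    have oJ: "over Rs J" using chain_outcome[OF c P(1) J(1)] by (simp add: chain_def)
    have "match (facts J) (\<nu> \<circ> \<sigma>) B" using P(2)[OF c J(1)] .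
    from fire[OF oJ r J(2) this]
    obtain \<sigma>' where s: "\<forall>x\<in>body_vars B. \<sigma>' x = (\<nu> \<circ> \<sigma>) x" "map \<sigma>' vs \<in> facts I' R" by blast
    from s(1) vs have "map \<sigma>' vs = map \<nu> (map \<sigma> vs)" by auto
    with s(2) show ?thesis by simp
  qed
  moreover have "set (Ps @ [proc_of (B, R, vs)]) \<subseteq> proc_of ` Rules"
    using P(1) r by simp
  ultimately show ?thesis
    unfolding forced_def by blast
qed

lemma forced_chain:
  "forced [(SucR, [i, Suc i])]" "forced [(ZeroR, [0])]" "forced [(InR, ins)]"
  unfolding forced_def
  by (intro exI[of _ "Suc i"] exI[of _ "[]"], auto simp: chain_def)+

end


section \<open>Recursive functions as sets of rules\<close>

text \<open>
  In a rule, the variables from 4 on hold the arguments of the function; the smaller ones hold its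
  value and counters.
\<close>

abbreviation args :: "nat \<Rightarrow> nat list" where
  "args k \<equiv> [4..<4 + k]"

abbreviation nums :: "nat \<Rightarrow> patom list" where
  "nums k \<equiv> map (\<lambda>x. (NumR, [x])) (args k)"

text \<open>Variable \<open>4 + k + j\<close> holds the value of \<open>gs ! j\<close>. The
  conjuncts \<open>nums k\<close> bind the arguments even if \<open>gs\<close> is empty.\<close>

abbreviation comp_body :: "recf \<Rightarrow> recf list \<Rightarrow> nat \<Rightarrow> patom list" where
  "comp_body f gs k \<equiv> nums k @ map (\<lambda>j. (EvR (gs ! j) k, (4 + k + j) # args k)) [0..<length gs] @
     [(EvR f (length gs), 0 # [4 + k..<4 + k + length gs])]"

text \<open>
  \<open>EvR f k\<close> holds of \<open>y # xs\<close> if \<open>f\<close> maps \<open>xs\<close> to \<open>y\<close>, and \<open>StepR (Mu f) k\<close> of \<open>n # xs\<close> if \<open>f\<close> is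
  defined and positive at all \<open>m # xs\<close> with \<open>m < n\<close>.  \<open>AuxR\<close> splits the recursive rules in two, as
  a procedure with safe scope cannot read the relation that it writes.
\<close>

primrec rules :: "recf \<Rightarrow> nat \<Rightarrow> rule set" where
  "rules Zero k = {((ZeroR, [0]) # nums k, EvR Zero k, 0 # args k)}"
| "rules Succ k = (if k = 1 then {([(SucR, [4, 0])], EvR Succ k, 0 # args k)} else {})"
| "rules (Proj i) k = (if i < k then {(nums k, EvR (Proj i) k, (4 + i) # args k)} else {})"
| "rules (Comp f gs) k = insert (comp_body f gs k, EvR (Comp f gs) k, 0 # args k)
     (rules f (length gs) \<union> \<Union> (set (map (\<lambda>r. r k) (map rules gs))))"
| "rules (PrimRec f g) k = (case k of 0 \<Rightarrow> {} | Suc j \<Rightarrow>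
     {([(ZeroR, [1]), (EvR f j, 0 # args j)], EvR (PrimRec f g) k, 0 # 1 # args j),
      ([(EvR (PrimRec f g) k, 0 # 1 # args j), (EvR g (Suc k), 2 # 1 # 0 # args j)],
        AuxR (PrimRec f g) k, 2 # 1 # args j),
      ([(AuxR (PrimRec f g) k, 2 # 1 # args j), (SucR, [1, 3])],
        EvR (PrimRec f g) k, 2 # 3 # args j)} \<union> rules f j \<union> rules g (Suc k))"
| "rules (Mu f) k =
     {((ZeroR, [0]) # nums k, StepR (Mu f) k, 0 # args k),
      ([(StepR (Mu f) k, 0 # args k), (EvR f (Suc k), 1 # 0 # args k), (SucR, [2, 1])],
        AuxR (Mu f) k, 0 # args k),
      ([(AuxR (Mu f) k, 0 # args k), (SucR, [0, 3])], StepR (Mu f) k, 3 # args k),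
      ([(StepR (Mu f) k, 0 # args k), (EvR f (Suc k), 1 # 0 # args k), (ZeroR, [1])],
        EvR (Mu f) k, 0 # args k)} \<union> rules f (Suc k)"

lemma finite_rules: "finite (rules f k)"
  by (induction f arbitrary: k) (auto split: nat.split)

section \<open>The standard model and the truth of the rules in it\<close>

definition mu_pos :: "recf \<Rightarrow> nat \<Rightarrow> nat list \<Rightarrow> bool" where
  "mu_pos f n xs \<longleftrightarrow> (\<forall>m<n. \<exists>y. rec_eval f (m # xs) (Suc y))"

text \<open>The intended meaning over the natural numbers. The relations \<open>AuxR\<close> are one
  step ahead of their counter: they record what holds at \<open>Suc n\<close> while the tuple still
  carries \<open>n\<close>. The comprehension for \<open>HaltR\<close> is \<open>{[0]}\<close> or
  empty.\<close>

fun model :: "recf \<Rightarrow> nat \<Rightarrow> nat \<Rightarrow> rsym \<Rightarrow> nat list set" where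
  "model q a b NumR = {[n] |n. True}"
| "model q a b SucR = {[n, Suc n] |n. True}"
| "model q a b ZeroR = {[0]}"
| "model q a b InR = {[a, b]}"
| "model q a b HaltR = {[0] |_::unit. rec_eval q [a, b] 0}"
| "model q a b (EvR f k) = {y # xs |y xs. length xs = k \<and> rec_eval f xs y}"
| "model q a b (StepR (Mu f) k) = {n # xs |n xs. length xs = k \<and> mu_pos f n xs}"
| "model q a b (AuxR (Mu f) k) = {n # xs |n xs. length xs = k \<and> mu_pos f (Suc n) xs}"
| "model q a b (AuxR (PrimRec f g) k) =
     {z # n # xs |z n xs. Suc (length xs) = k \<and> rec_eval (PrimRec f g) (Suc n # xs) z}"
| "model q a b _ = {}"

text \<open>Full as for tgds: no variable is existential, so the assignment that matches the body
  must itself satisfy the head.\<close>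

definition full_rule :: "(rsym \<Rightarrow> nat list set) \<Rightarrow> rule \<Rightarrow> bool" where
  "full_rule M r \<longleftrightarrow> ok_rule r \<and> set (snd (snd r)) \<subseteq> body_vars (fst r) \<and>
     (\<forall>\<sigma>. match M \<sigma> (fst r) \<longrightarrow> match M \<sigma> [snd r])"

lemma sound_full_rule: "full_rule M r \<Longrightarrow> sound_rule M r"
  unfolding full_rule_def sound_rule_def
  by (intro allI impI, rule_tac x = \<sigma> in exI) (auto intro: le_SucI)

lemma body_vars_simps [simp]:
  "body_vars [] = {}"
  "body_vars (p # B) = set (snd p) \<union> body_vars B"
  "body_vars (B @ B') = body_vars B \<union> body_vars B'"
  "body_vars (nums k) = set (args k)"
  by (auto simp: body_vars_def)

text \<open>No term is its own immediate subterm. Hence the relations of subterms in a body differ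
  from the head relation, as \<open>ok_rule\<close> demands.\<close>

lemma size_recf [simp]:
  "f \<noteq> PrimRec f g" "g \<noteq> PrimRec f g" "f \<noteq> Mu f" "f \<noteq> Comp f gs"
  by (auto dest: arg_cong[where f = size])

lemma size_recf_nth: "j < length gs \<Longrightarrow> Comp f gs \<noteq> gs ! j"
proof
  assume "j < length gs" and e: "Comp f gs = gs ! j"
  then have "size (gs ! j) \<le> size_list size gs"
    by (intro size_list_estimation'[of "gs ! j"]) auto
  with arg_cong[OF e, of size] show False by simp
qed

lemma match_nums [simp]: "match (model q a b) \<sigma> (nums k)"
  by (auto simp: match_def)

text \<open>Read in \<open>model\<close>, a rule is an inference of \<open>rec_eval\<close>, half of
  one, or part of a step of the search described by \<open>mu_pos\<close>. The induction collects
  the rules of the subterms.\<close>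

lemma full_rules: "r \<in> rules f k \<Longrightarrow> full_rule (model q a b) r"
proof (induction f arbitrary: k)
  case Zero
  then show ?case by (auto simp: full_rule_def ok_rule_def intro: rec_eval.zero)
next
  case Succ
  then show ?case by (auto simp: full_rule_def ok_rule_def intro: rec_eval.succ split: if_splits)
next
  case (Proj i)
  then have i: "i < k" and r: "r = (nums k, EvR (Proj i) k, (4 + i) # args k)"
    by (auto split: if_splits)
  have "rec_eval (Proj i) (map \<sigma> (args k)) (\<sigma> (4 + i))" for \<sigma> :: "nat \<Rightarrow> nat"
    using rec_eval.proj[of i "map \<sigma> (args k)"] i by simp
  with i show ?case by (auto simp: r full_rule_def ok_rule_def)
next
  case (Comp f gs)
  have *: "full_rule (model q a b) (comp_body f gs k, EvR (Comp f gs) k, 0 # args k)"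
  proof -
    have "rec_eval (Comp f gs) (map \<sigma> (args k)) (\<sigma> 0)"
      if "match (model q a b) \<sigma> (comp_body f gs k)" for \<sigma>
    proof -
      have "\<And>j. j < length gs \<Longrightarrow> rec_eval (gs ! j) (map \<sigma> (args k)) (\<sigma> (4 + k + j))"
        and f: "rec_eval f (map \<sigma> [4 + k..<4 + k + length gs]) (\<sigma> 0)"
        using that by (auto simp: match_def[of _ _ "map _ [0..<length gs]"])
      then have "list_all2 (\<lambda>g y. rec_eval g (map \<sigma> (args k)) y) gs (map \<sigma> [4 + k..<4 + k + length gs])"
        by (simp add: list_all2_conv_all_nth)
      then show ?thesis using f by (rule rec_eval.comp)
    qed
    then show ?thesis by (auto simp: full_rule_def ok_rule_def size_recf_nth)
  qed
  from Comp.prems consider "r = (comp_body f gs k, EvR (Comp f gs) k, 0 # args k)"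
    | "r \<in> rules f (length gs)" | g where "g \<in> set gs" "r \<in> rules g k" by auto
  then show ?case using Comp.IH * by cases auto
next
  case (PrimRec f g)
  then obtain j where k: "k = Suc j" by (auto split: nat.splits)
  from PrimRec.prems[unfolded rules.simps k nat.case]
  consider "r = ([(ZeroR, [1]), (EvR f j, 0 # args j)], EvR (PrimRec f g) k, 0 # 1 # args j)"
    | "r = ([(EvR (PrimRec f g) k, 0 # 1 # args j), (EvR g (Suc k), 2 # 1 # 0 # args j)],
        AuxR (PrimRec f g) k, 2 # 1 # args j)"
    | "r = ([(AuxR (PrimRec f g) k, 2 # 1 # args j), (SucR, [1, 3])],
        EvR (PrimRec f g) k, 2 # 3 # args j)"
    | "r \<in> rules f j" | "r \<in> rules g (Suc k)" unfolding k by blast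
  then show ?case
  proof cases
    case 1
    then show ?thesis by (simp add: full_rule_def ok_rule_def k rec_eval.prim_0)
  next
    case 2
    then show ?thesis by (auto simp: full_rule_def ok_rule_def k elim: rec_eval.prim_Suc)
  next
    case 3
    then show ?thesis by (auto simp: full_rule_def ok_rule_def k)
  qed (rule PrimRec.IH, assumption)+
next
  case (Mu f)
  from Mu.prems[unfolded rules.simps]
  consider "r = ((ZeroR, [0]) # nums k, StepR (Mu f) k, 0 # args k)"
    | "r = ([(StepR (Mu f) k, 0 # args k), (EvR f (Suc k), 1 # 0 # args k), (SucR, [2, 1])],
        AuxR (Mu f) k, 0 # args k)"
    | "r = ([(AuxR (Mu f) k, 0 # args k), (SucR, [0, 3])], StepR (Mu f) k, 3 # args k)"
    | "r = ([(StepR (Mu f) k, 0 # args k), (EvR f (Suc k), 1 # 0 # args k), (ZeroR, [1])],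
        EvR (Mu f) k, 0 # args k)"
    | "r \<in> rules f (Suc k)" by blast
  then show ?case
  proof cases
    case 1
    then show ?thesis by (auto simp: full_rule_def ok_rule_def mu_pos_def)
  next
    case 2
    then show ?thesis by (auto simp: full_rule_def ok_rule_def mu_pos_def less_Suc_eq)
  next
    case 3
    then show ?thesis by (auto simp: full_rule_def ok_rule_def)
  next
    case 4
    then show ?thesis by (auto simp: full_rule_def ok_rule_def mu_pos_def intro: rec_eval.mu)
  qed (rule Mu.IH, assumption)
qed

section \<open>Completeness: true evaluations are forced\<close>

text \<open>The last rule is the existential one. The detour through \<open>NumR\<close> is there
  because a rule with \<open>SucR\<close> in both body and head would violate
  \<open>ok_rule\<close>.\<close>

definition base_rules :: "rule set" where
  "base_rules = {([(ZeroR, [0])], NumR, [0]), ([(SucR, [0, 1])], NumR, [1]), ([(NumR, [0])], SucR, [0, 1])}"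

text \<open>Follows the variable convention of \<open>rules\<close>: \<open>ls\<close>, of length 4,
  for the small variables, \<open>xs\<close> for the arguments, \<open>ys\<close> for the inner
  results of a composition.\<close>

definition asg :: "nat list \<Rightarrow> nat list \<Rightarrow> nat list \<Rightarrow> nat \<Rightarrow> nat" where
  "asg ls xs ys i = (ls @ xs @ ys) ! i"

lemma asg_simps [simp]:
  "asg (w # ls) xs ys 0 = w"
  "asg (w # w0 # ls) xs ys (Suc 0) = w0"
  "asg (w # w0 # w1 # ls) xs ys 2 = w1"
  "asg (w # w0 # w1 # w2 # ls) xs ys 3 = w2"
  "length ls = 4 \<Longrightarrow> j < length xs \<Longrightarrow> asg ls xs ys (4 + j) = xs ! j"
  "length ls = 4 \<Longrightarrow> j < length ys \<Longrightarrow> asg ls xs ys (4 + length xs + j) = ys ! j"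
  by (simp_all add: asg_def nth_append numeral_2_eq_2 numeral_3_eq_3)

lemma asg_args [simp]:
  assumes "length ls = 4"
  shows "map (asg ls xs ys) (args (length xs)) = xs"
    "map (asg ls xs ys) [4 + length xs..<4 + length xs + length ys] = ys"
  using assms by (auto intro!: nth_equalityI)

context program
begin

lemma forced_num:
  assumes "base_rules \<subseteq> Rules"
  shows "forced [(NumR, [n])]"
proof (cases n)
  case 0
  have "forced [(NumR, map (\<lambda>_::nat. 0) [0])]"
    by (rule forced_rule[of "[(ZeroR, [0])]"]) (use assms forced_chain(2) in \<open>auto simp: base_rules_def\<close>)
  then show ?thesis using 0 by simp
next
  case (Suc m)
  have "forced [(NumR, map (\<lambda>i::nat. m + i) [1])]"
    by (rule forced_rule[of "[(SucR, [0, 1])]"]) (use assms forced_chain(1) in \<open>auto simp: base_rules_def\<close>)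
  then show ?thesis using Suc by simp
qed

lemma forced_nums:
  assumes "base_rules \<subseteq> Rules" "p \<in> set (nums k)"
  shows "forced [(fst p, map \<sigma> (snd p))]"
  using assms(2) forced_num[OF assms(1)] by auto

text \<open>Induction on the evaluation: each inference of \<open>rec_eval\<close> is replayed by
  \<open>forced_rule\<close> under a suitable \<open>asg\<close>.\<close>

lemma forced_eval:
  assumes "rec_eval f xs y" and base: "base_rules \<subseteq> Rules" and "rules f (length xs) \<subseteq> Rules"
  shows "forced [(EvR f (length xs), y # xs)]"
  using assms(1,3)
proof (induction rule: rec_eval.induct)
  case (zero xs)
  let ?\<sigma> = "asg [0, 0, 0, 0] xs []"
  have "forced [(EvR Zero (length xs), map ?\<sigma> (0 # args (length xs)))]"
    by (rule forced_rule[of "(ZeroR, [0]) # nums (length xs)"])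
       (use zero forced_num[OF base] forced_chain(2) in auto)
  then show ?case by simp
next
  case (succ x)
  let ?\<sigma> = "asg [Suc x, 0, 0, 0] [x] []"
  have s: "?\<sigma> 4 = x" using asg_simps(5)[of "[Suc x, 0, 0, 0]" 0 "[x]" "[]"] by simp
  have "forced [(EvR Succ 1, map ?\<sigma> (0 # args 1))]"
    by (rule forced_rule[of "[(SucR, [4, 0])]"]) (use succ forced_chain(1) s in auto)
  then show ?case using s by simp
next
  case (proj i xs)
  let ?\<sigma> = "asg [0, 0, 0, 0] xs []"
  have "forced [(EvR (Proj i) (length xs), map ?\<sigma> ((4 + i) # args (length xs)))]"
    by (rule forced_rule[of "nums (length xs)"]) (use proj forced_num[OF base] in auto)
  then show ?case using proj(1) by simp
next
  case (comp xs gs ys f z)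
  let ?\<sigma> = "asg [z, 0, 0, 0] xs ys" and ?k = "length xs"
  have l: "length gs = length ys" using comp.IH(1) by (simp add: list_all2_lengthD)
  have g: "forced [(EvR (gs ! j) ?k, ys ! j # xs)]" if "j < length gs" for j
  proof -
    have "rules (gs ! j) ?k \<subseteq> Rules"
      using comp.prems UN_upper[OF nth_mem[OF that], of "\<lambda>g. rules g ?k"]
      by simp (blast intro: subset_trans)
    with comp.IH(1) that show ?thesis by (simp add: list_all2_conv_all_nth)
  qed
  have f: "forced [(EvR f (length gs), z # ys)]"
    using comp.IH(2) comp.prems l by simp
  have "forced [(EvR (Comp f gs) ?k, map ?\<sigma> (0 # args ?k))]"
  proof (rule forced_rule[of "comp_body f gs ?k"])
    fix p assume "p \<in> set (comp_body f gs ?k)"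
    then consider "p \<in> set (nums ?k)"
      | j where "j < length gs" "p = (EvR (gs ! j) ?k, (4 + ?k + j) # args ?k)"
      | "p = (EvR f (length gs), 0 # [4 + ?k..<4 + ?k + length gs])" by auto
    then show "forced [(fst p, map ?\<sigma> (snd p))]"
    proof cases
      case 1
      then show ?thesis by (rule forced_nums[OF base])
    next
      case 2
      then show ?thesis using g l by simp
    next
      case 3
      then show ?thesis using f l by simp
    qed
  qed (use comp.prems in auto)
  then show ?case by simp
next
  case (prim_0 f xs y g)
  let ?\<sigma> = "asg [y, 0, 0, 0] xs []" and ?k = "length xs"
  have f: "forced [(EvR f ?k, y # xs)]" using prim_0 by simp
  have "forced [(EvR (PrimRec f g) (Suc ?k), map ?\<sigma> (0 # 1 # args ?k))]"
    by (rule forced_rule[of "[(ZeroR, [1]), (EvR f ?k, 0 # args ?k)]"])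
       (use prim_0.prems f forced_chain(2) in auto)
  then show ?case by simp
next
  case (prim_Suc f g n xs y z)
  \<comment> \<open>Variables 0 and 2 hold the values at \<open>n\<close> and at
    \<open>Suc n\<close>, variables 1 and 3 the two counters.\<close>
  let ?P = "PrimRec f g" and ?\<sigma> = "asg [y, n, z, Suc n] xs []" and ?k = "length xs"
  have P: "forced [(EvR ?P (Suc ?k), y # n # xs)]" "forced [(EvR g (Suc (Suc ?k)), z # n # y # xs)]"
    using prim_Suc by simp_all
  have "forced [(AuxR ?P (Suc ?k), map ?\<sigma> (2 # 1 # args ?k))]"
    by (rule forced_rule[of "[(EvR ?P (Suc ?k), 0 # 1 # args ?k), (EvR g (Suc (Suc ?k)), 2 # 1 # 0 # args ?k)]"])
       (use prim_Suc.prems P in auto)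
  then have a: "forced [(AuxR ?P (Suc ?k), z # n # xs)]" by simp
  have "forced [(EvR ?P (Suc ?k), map ?\<sigma> (2 # 3 # args ?k))]"
    by (rule forced_rule[of "[(AuxR ?P (Suc ?k), 2 # 1 # args ?k), (SucR, [1, 3])]"])
       (use prim_Suc.prems a forced_chain(1) in auto)
  then show ?case by simp
next
  case (mu f n xs)
  let ?M = "Mu f" and ?k = "length xs"
  \<comment> \<open>The search is followed up to \<open>n\<close>; below \<open>n\<close> the
    premises of \<open>mu\<close> supply positive values.\<close>
  have step: "forced [(StepR ?M ?k, m # xs)]" if "m \<le> n" for m
    using that
  proof (induction m)
    case 0
    let ?\<sigma> = "asg [0, 0, 0, 0] xs []"
    have "forced [(StepR ?M ?k, map ?\<sigma> (0 # args ?k))]"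
      by (rule forced_rule[of "(ZeroR, [0]) # nums ?k"])
         (use mu.prems forced_num[OF base] forced_chain(2) in auto)
    then show ?case by simp
  next
    case (Suc m)
    then obtain y where y: "forced [(EvR f (Suc ?k), Suc y # m # xs)]"
      using mu.IH(2)[of m] mu.prems by auto
    \<comment> \<open>Variable 2 is the predecessor of the value in variable 1, which witnesses that
      the value is positive; variable 3 is the next counter.\<close>
    let ?\<sigma> = "asg [m, Suc y, y, Suc m] xs []"
    have "forced [(AuxR ?M ?k, map ?\<sigma> (0 # args ?k))]"
      by (rule forced_rule[of "[(StepR ?M ?k, 0 # args ?k), (EvR f (Suc ?k), 1 # 0 # args ?k), (SucR, [2, 1])]"])
         (use mu.prems y Suc forced_chain(1) in auto)
    then have a: "forced [(AuxR ?M ?k, m # xs)]" by simp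
    have "forced [(StepR ?M ?k, map ?\<sigma> (3 # args ?k))]"
      by (rule forced_rule[of "[(AuxR ?M ?k, 0 # args ?k), (SucR, [0, 3])]"])
         (use mu.prems a forced_chain(1) in auto)
    then show ?case by simp
  qed
  have f: "forced [(EvR f (Suc ?k), 0 # n # xs)]" using mu.IH(1) mu.prems by simp
  let ?\<sigma> = "asg [n, 0, 0, 0] xs []"
  have "forced [(EvR ?M ?k, map ?\<sigma> (0 # args ?k))]"
    by (rule forced_rule[of "[(StepR ?M ?k, 0 # args ?k), (EvR f (Suc ?k), 1 # 0 # args ?k), (ZeroR, [1])]"])
       (use mu.prems step[of n] f forced_chain(2) in auto)
  then show ?case by simp
qed

section \<open>Lengthening the chain\<close>

text \<open>The base rules put the last element of the chain into \<open>NumR\<close> and then give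
  it a successor, which is appended. It may be any value, even an old one, as a chain need not be
  injective. The update at \<open>Suc n\<close> leaves the input fact alone because
  \<open>ins\<close> stays below.\<close>

lemma chain_extend:
  assumes base: "base_rules \<subseteq> Rules" and ins: "set ins \<subseteq> {..n}"
  shows "\<exists>Ps. set Ps \<subseteq> proc_of ` Rules \<and>
    (\<forall>\<nu> I. chain \<nu> n I \<longrightarrow> (\<forall>I'\<in>outcomes_seq Ps I. \<exists>\<nu>'. chain \<nu>' (Suc n) I'))"
proof -
  have r: "([(ZeroR, [0])], NumR, [0]) \<in> Rules" "([(SucR, [0, 1])], NumR, [1]) \<in> Rules"
    "([(NumR, [0])], SucR, [0, 1]) \<in> Rules"
    using base by (auto simp: base_rules_def)
  let ?Ps = "map proc_of [([(ZeroR, [0])], NumR, [0]), ([(SucR, [0, 1])], NumR, [1]),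
    ([(NumR, [0])], SucR, [0, 1])]"
  have "\<exists>\<nu>'. chain \<nu>' (Suc n) I3" if c: "chain \<nu> n I" and I3: "I3 \<in> outcomes_seq ?Ps I" for \<nu> I I3
  proof -
    obtain I1 I2 where I: "I1 \<in> outcomes (proc_of ([(ZeroR, [0])], NumR, [0])) I"
      "I2 \<in> outcomes (proc_of ([(SucR, [0, 1])], NumR, [1])) I1"
      "I3 \<in> outcomes (proc_of ([(NumR, [0])], SucR, [0, 1])) I2"
      using I3 by auto
    have o: "over Rs I" using c by (simp add: chain_def)
    have o1: "over Rs I1" by (rule outcomes_mono(1)[OF o r(1) I(1)])
    have o2: "over Rs I2" by (rule outcomes_mono(1)[OF o1 r(2) I(2)])
    have c1: "chain \<nu> n I1"
      using chain_outcome[OF c, of "[proc_of ([(ZeroR, [0])], NumR, [0])]" I1] I(1) r(1) by simp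
    have c3: "chain \<nu> n I3" using chain_outcome[OF c _ I3] r by simp
    \<comment> \<open>The last element is either the zero of the chain or the end of a link; the
      first two base rules cover these cases.\<close>
    have num: "[\<nu> n] \<in> facts I2 NumR"
    proof (cases n)
      case 0
      have m: "match (facts I) (\<lambda>_. \<nu> 0) [(ZeroR, [0])]" using c by (simp add: chain_def)
      obtain \<sigma> where "\<forall>x\<in>body_vars [(ZeroR, [0])]. \<sigma> x = \<nu> 0" "map \<sigma> [0] \<in> facts I1 NumR"
        using fire[OF o r(1) I(1) m] by blast
      then have "[\<nu> n] \<in> facts I1 NumR" using 0 by simp
      then show ?thesis using outcomes_mono(2)[OF o1 r(2) I(2)] by (rule rev_subsetD)
    next
      case (Suc m)
      have m: "match (facts I1) (\<lambda>i. \<nu> (m + i)) [(SucR, [0, 1])]" using c1 Suc by (simp add: chain_def)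
      obtain \<sigma> where "\<forall>x\<in>body_vars [(SucR, [0, 1])]. \<sigma> x = \<nu> (m + x)"
        "map \<sigma> [1] \<in> facts I2 NumR"
        using fire[OF o1 r(2) I(2) m] by blast
      then show ?thesis using Suc by simp
    qed
    then have m: "match (facts I2) (\<lambda>_. \<nu> n) [(NumR, [0])]" by simp
    obtain \<sigma> where \<sigma>: "\<forall>x\<in>body_vars [(NumR, [0])]. \<sigma> x = \<nu> n" "map \<sigma> [0, 1] \<in> facts I3 SucR"
      using fire[OF o2 r(3) I(3) m] by blast
    define v where "v = \<sigma> 1"
    have v: "[\<nu> n, v] \<in> facts I3 SucR" using \<sigma> by (simp add: v_def)
    have "map (\<nu>(Suc n := v)) ins = map \<nu> ins" using ins by auto
    then have "map (\<nu>(Suc n := v)) ins \<in> facts I3 InR" using c3 by (simp only: chain_def)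
    moreover have "\<forall>i<Suc n. [(\<nu>(Suc n := v)) i, (\<nu>(Suc n := v)) (Suc i)] \<in> facts I3 SucR"
      using c3 v by (simp add: chain_def less_Suc_eq)
    ultimately have "chain (\<nu>(Suc n := v)) (Suc n) I3"
      using c3 by (simp add: chain_def)
    then show ?thesis by blast
  qed
  note ext = this
  show ?thesis
  proof (rule exI[of _ ?Ps], intro conjI allI impI ballI)
    show "set ?Ps \<subseteq> proc_of ` Rules" using r by simp
  qed (rule ext)
qed

lemma chain_exists:
  assumes base: "base_rules \<subseteq> Rules" and ins: "set ins \<subseteq> {..n}" and c: "chain \<nu> n I"
  shows "\<exists>Ps. set Ps \<subseteq> proc_of ` Rules \<and> (\<forall>I'\<in>outcomes_seq Ps I. \<exists>\<nu>. chain \<nu> (n + m) I')"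
proof (induction m)
  case 0
  show ?case using c by (intro exI[of _ "[]"]) auto
next
  case (Suc m)
  then obtain Ps where P: "set Ps \<subseteq> proc_of ` Rules" "\<And>J. J \<in> outcomes_seq Ps I \<Longrightarrow> \<exists>\<nu>. chain \<nu> (n + m) J"
    by blast
  have "set ins \<subseteq> {..n + m}" using ins by auto
  from chain_extend[OF base this] obtain Qs where Q: "set Qs \<subseteq> proc_of ` Rules"
    "\<And>\<nu> J J'. chain \<nu> (n + m) J \<Longrightarrow> J' \<in> outcomes_seq Qs J \<Longrightarrow> \<exists>\<nu>'. chain \<nu>' (Suc (n + m)) J'"
    by blast
  have "\<exists>\<nu>. chain \<nu> (n + Suc m) I'" if I': "I' \<in> outcomes_seq (Ps @ Qs) I" for I'
  proof -
    obtain J where J: "J \<in> outcomes_seq Ps I" "I' \<in> outcomes_seq Qs J" using I' by auto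
    obtain \<nu> where "chain \<nu> (n + m) J" using P(2)[OF J(1)] by blast
    from Q(2)[OF this J(2)] show ?thesis by simp
  qed
  then show ?case using P(1) Q(1) by (intro exI[of _ "Ps @ Qs"]) simp
qed

text \<open>First the chain is lengthened to \<open>n + m\<close>, then the forcing sequence is run.
  Each outcome may have its own chain, which is harmless since \<open>forced\<close> is uniform in
  it.\<close>

lemma forced_outcomes:
  assumes base: "base_rules \<subseteq> Rules" and ins: "set ins \<subseteq> {..n}" and c: "chain \<nu> n I"
    and F: "forced Fs"
  shows "\<exists>Ps. set Ps \<subseteq> proc_of ` Rules \<and> (\<forall>I'\<in>outcomes_seq Ps I. over Rs I' \<and> (\<exists>\<nu>. match (facts I') \<nu> Fs))"
proof -
  obtain m Qs where Q: "set Qs \<subseteq> proc_of ` Rules"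
    "\<And>\<nu> I I'. chain \<nu> m I \<Longrightarrow> I' \<in> outcomes_seq Qs I \<Longrightarrow> match (facts I') \<nu> Fs"
    using F unfolding forced_def by blast
  obtain Ps where P: "set Ps \<subseteq> proc_of ` Rules" "\<And>J. J \<in> outcomes_seq Ps I \<Longrightarrow> \<exists>\<nu>. chain \<nu> (n + m) J"
    using chain_exists[OF base ins c, of m] by blast
  have "over Rs I' \<and> (\<exists>\<nu>. match (facts I') \<nu> Fs)" if I': "I' \<in> outcomes_seq (Ps @ Qs) I" for I'
  proof -
    obtain J where J: "J \<in> outcomes_seq Ps I" "I' \<in> outcomes_seq Qs J" using I' by auto
    obtain \<nu> where \<nu>: "chain \<nu> m J" using P(2)[OF J(1)] chain_le[of _ "n + m" J m] by force
    have "over Rs I'" using chain_outcome[OF \<nu> Q(1) J(2)] by (simp add: chain_def)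
    then show ?thesis using Q(2)[OF \<nu> J(2)] by blast
  qed
  then show ?thesis using P(1) Q(1) by (intro exI[of _ "Ps @ Qs"]) simp
qed

end

section \<open>Reduction of evaluation to zero to readiness\<close>

text \<open>The value 0 is singled out because a negative answer of the supposed decider has to
  cause readiness.\<close>

definition halt_rule :: "recf \<Rightarrow> rule" where
  "halt_rule q = ([(InR, [0, 1]), (EvR q 2, [2, 0, 1]), (ZeroR, [2])], HaltR, [2])"

text \<open>The rules depend on \<open>q\<close> only. Its arguments enter through the instance,
  which the diagonal choice of \<open>a\<close> and \<open>b\<close> relies on.\<close>

definition halt_rules :: "recf \<Rightarrow> rule set" where
  "halt_rules q = insert (halt_rule q) (base_rules \<union> rules q 2)"

definition halt_rels :: "recf \<Rightarrow> rsym set" where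
  "halt_rels q = {NumR, SucR, ZeroR, InR, HaltR} \<union> (\<Union>r\<in>halt_rules q. rule_rels r)"

lemma finite_halt_rules: "finite (halt_rules q)"
  by (simp add: halt_rules_def base_rules_def finite_rules)

lemma ok_halt_rules:
  assumes "r \<in> halt_rules q"
  shows "ok_rule r"
proof (cases "r \<in> rules q 2")
  case True
  then show ?thesis using full_rules unfolding full_rule_def by blast
next
  case False
  then show ?thesis
    using assms by (auto simp: halt_rules_def halt_rule_def base_rules_def ok_rule_def)
qed

lemma sound_halt_rules:
  assumes "r \<in> halt_rules q"
  shows "sound_rule (model q a b) r"
proof -
  \<comment> \<open>The true successor of a number up to \<open>b\<close> is at most
    \<open>Suc b\<close>.\<close>
  have "sound_rule (model q a b) ([(NumR, [0])], SucR, [0, 1])"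
    unfolding sound_rule_def
    by (intro allI impI, rule_tac x = "\<lambda>x. if x = 0 then \<sigma> 0 else Suc (\<sigma> 0)" in exI) auto
  moreover have "full_rule (model q a b) ([(ZeroR, [0])], NumR, [0])"
    "full_rule (model q a b) ([(SucR, [0, 1])], NumR, [1])" "full_rule (model q a b) (halt_rule q)"
    by (auto simp: full_rule_def ok_rule_def halt_rule_def)
  ultimately show ?thesis
    using assms full_rules[of r q 2 q a b] sound_full_rule
    unfolding halt_rules_def base_rules_def by blast
qed

lemma halt_program: "program (halt_rels q) (halt_rules q)"
proof
  show "finite (halt_rels q)"
    by (auto simp: halt_rels_def finite_halt_rules rule_rels_def)
  show "r \<in> halt_rules q \<Longrightarrow> ok_rule r" for r by (rule ok_halt_rules)
  show "r \<in> halt_rules q \<Longrightarrow> rule_rels r \<subseteq> halt_rels q" for r by (auto simp: halt_rels_def)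
qed

text \<open>A chain up to \<open>a + b\<close> contains both inputs and has an easily computed
  length.\<close>

definition start_facts :: "nat \<Rightarrow> nat \<Rightarrow> rsym \<Rightarrow> nat list set" where
  "start_facts a b R = (case R of SucR \<Rightarrow> (\<lambda>i. [i, Suc i]) ` {..<a + b} | ZeroR \<Rightarrow> {[0]} | InR \<Rightarrow> {[a, b]} | _ \<Rightarrow> {})"

definition start :: "recf \<Rightarrow> nat \<Rightarrow> nat \<Rightarrow> db" where
  "start q a b = db_of (halt_rels q) (start_facts a b)"

definition halt_query :: cq where
  "halt_query = CQ [] [atom_of (HaltR, [0])]"

lemma over_start_facts: "finite Rs \<Longrightarrow> over Rs (db_of Rs (start_facts a b))"
  by (rule over_db_of) (auto simp: start_facts_def split: rsym.splits)

lemma halt_rels_base: "{NumR, SucR, ZeroR, InR, HaltR} \<subseteq> halt_rels q"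
  by (simp add: halt_rels_def)

lemma over_start: "over (halt_rels q) (start q a b)"
  unfolding start_def by (rule over_start_facts) (rule program.finite_rels[OF halt_program])

lemma facts_start: "facts (start q a b) R \<subseteq> start_facts a b R"
  using over_facts_empty[OF over_start] by (cases "R \<in> halt_rels q") (auto simp: start_def)

lemma satisfies_halt_query:
  assumes "over (halt_rels q) I"
  shows "satisfies I halt_query \<longleftrightarrow> (\<exists>n. [n] \<in> facts I HaltR)"
proof -
  have "sat_atoms I \<tau> [atom_of (HaltR, [0])] \<longleftrightarrow> [val_no (\<tau> 0)] \<in> facts I HaltR" for \<tau>
    using sat_atoms_of[OF assms, of "[(HaltR, [0])]"] halt_rels_base by simp
  then have "satisfies I halt_query \<longleftrightarrow> (\<exists>\<tau> :: var \<Rightarrow> val. [val_no (\<tau> 0)] \<in> facts I HaltR)"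
    by (simp add: satisfies_def halt_query_def del: atom_of.simps)
  also have "\<dots> \<longleftrightarrow> (\<exists>n. [n] \<in> facts I HaltR)"
  proof
    assume "\<exists>n. [n] \<in> facts I HaltR"
    then obtain n where "[n] \<in> facts I HaltR" by blast
    then show "\<exists>\<tau> :: var \<Rightarrow> val. [val_no (\<tau> 0)] \<in> facts I HaltR"
      by (intro exI[of _ "\<lambda>_. Val n"]) simp
  qed auto
  finally show ?thesis .
qed

text \<open>If the sequence works, it works for the outcome inside \<open>model\<close>, where
  \<open>HaltR\<close> is inhabited only if \<open>q\<close> yields 0. Conversely, the evaluation is
  forced, and \<open>halt_rule\<close> turns it into a fact of \<open>HaltR\<close>.\<close>

lemma halt_readiness:
  "(start q a b, proc_of ` halt_rules q, halt_query) \<in> query_readiness \<longleftrightarrow> rec_eval q [a, b] 0"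
proof
  assume "(start q a b, proc_of ` halt_rules q, halt_query) \<in> query_readiness"
  then obtain Ps where Ps: "set Ps \<subseteq> proc_of ` halt_rules q"
    "\<And>I'. I' \<in> outcomes_seq Ps (start q a b) \<Longrightarrow> satisfies I' halt_query"
    by (auto simp: query_readiness_def)
  have "start_facts a b R \<subseteq> model q a b R" for R
    by (cases R) (auto simp: start_facts_def)
  then have "facts (start q a b) R \<subseteq> model q a b R" for R
    using facts_start by blast
  then obtain I' where I': "I' \<in> outcomes_seq Ps (start q a b)" "over (halt_rels q) I'"
    "\<And>R. facts I' R \<subseteq> model q a b R"
    using program.sound_outcome_seq[OF halt_program over_start sound_halt_rules Ps(1)] by metis
  obtain n where "[n] \<in> facts I' HaltR"
    using Ps(2)[OF I'(1)] satisfies_halt_query[OF I'(2)] by blast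
  then have "[n] \<in> model q a b HaltR" using I'(3) by blast
  then show "rec_eval q [a, b] 0" by simp
next
  assume q: "rec_eval q [a, b] 0"
  interpret p: program "halt_rels q" "halt_rules q" "[a, b]" by (rule halt_program)
  have base: "base_rules \<subseteq> halt_rules q" and "rules q (length [a, b]) \<subseteq> halt_rules q"
    by (auto simp: halt_rules_def numeral_2_eq_2)
  then have ev: "p.forced [(EvR q 2, [0, a, b])]"
    using p.forced_eval[OF q] by (simp add: numeral_2_eq_2)
  \<comment> \<open>In \<open>halt_rule\<close> the variables 0, 1 and 2 stand for \<open>a\<close>,
    \<open>b\<close> and the value 0.\<close>
  have h: "p.forced [(HaltR, map (\<lambda>i. [a, b, 0] ! i) [2])]"
  proof (rule p.forced_rule[of "[(InR, [0, 1]), (EvR q 2, [2, 0, 1]), (ZeroR, [2])]"])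
    show "([(InR, [0, 1]), (EvR q 2, [2, 0, 1]), (ZeroR, [2])], HaltR, [2]) \<in> halt_rules q"
      by (simp add: halt_rules_def halt_rule_def)
  qed (use ev p.forced_chain(2,3) in auto)
  \<comment> \<open>In the start instance numbers stand for themselves.\<close>
  have c: "p.chain id (a + b) (start q a b)"
    using over_start[of q a b] halt_rels_base[of q]
    by (auto simp: p.chain_def start_def start_facts_def)
  have "set [a, b] \<subseteq> {..a + b}" by simp
  from p.forced_outcomes[OF base this c h] obtain Ps where Ps: "set Ps \<subseteq> proc_of ` halt_rules q"
    "\<And>I'. I' \<in> outcomes_seq Ps (start q a b) \<Longrightarrow>
      over (halt_rels q) I' \<and> (\<exists>\<nu>. match (facts I') \<nu> [(HaltR, map (\<lambda>i. [a, b, 0] ! i) [2])])"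
    by blast
  have sat: "satisfies I' halt_query" if "I' \<in> outcomes_seq Ps (start q a b)" for I'
    using Ps(2)[OF that] satisfies_halt_query by auto
  \<comment> \<open>\<open>HaltR\<close> is empty at the start, so the query cannot hold without
    applying a procedure.\<close>
  have "Ps \<noteq> []"
  proof
    assume "Ps = []"
    then obtain n where "[n] \<in> facts (start q a b) HaltR"
      using sat satisfies_halt_query[OF over_start] by auto
    then show False using facts_start by (fastforce simp: start_facts_def)
  qed
  with sat Ps(1) show "(start q a b, proc_of ` halt_rules q, halt_query) \<in> query_readiness"
    by (auto simp: query_readiness_def)
qed

lemma halt_inputs:
  "(start q a b, proc_of ` halt_rules q, halt_query) \<in> {(I, \<Pi>, Q) \<in> readiness_inputs.
     (\<forall>P\<in>\<Pi>. safe_scope P) \<and> (\<exists>a. cq_atoms Q = [a])}"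
  using over_start[of q a b] ok_halt_rules[of _ q] wf_atom_of[of "(HaltR, [0])"]
  by (auto simp: readiness_inputs_def over_def finite_halt_rules wf_proc_of safe_scope_proc_of
      boolean_def halt_query_def wf_cq_def wf_conj_def)


section \<open>Recursive construction of the inputs\<close>

lemma rec_eval_comp1: "rec_eval g xs y \<Longrightarrow> rec_eval f [y] z \<Longrightarrow> rec_eval (Comp f [g]) xs z"
  by (rule rec_eval.comp[of _ _ "[y]"]) simp_all

lemma rec_eval_comp2:
  "rec_eval g xs y \<Longrightarrow> rec_eval h xs y' \<Longrightarrow> rec_eval f [y, y'] z \<Longrightarrow> rec_eval (Comp f [g, h]) xs z"
  by (rule rec_eval.comp[of _ _ "[y, y']"]) simp_all

lemma rec_eval_Suc: "rec_eval g xs y \<Longrightarrow> rec_eval (Comp Succ [g]) xs (Suc y)"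
  by (rule rec_eval_comp1[OF _ rec_eval.succ])

lemma rec_eval_Proj:
  "rec_eval (Proj 0) (x # xs) x" "rec_eval (Proj 1) (x # y # xs) y"
  using rec_eval.proj[of 0 "x # xs"] rec_eval.proj[of 1 "x # y # xs"] by simp_all

primrec const_rec :: "nat \<Rightarrow> recf" where
  "const_rec 0 = Zero"
| "const_rec (Suc n) = Comp Succ [const_rec n]"

lemma rec_eval_const: "rec_eval (const_rec n) xs n"
  by (induction n) (auto intro: rec_eval.zero rec_eval_Suc)

section \<open>Recursive functions that compute codes\<close>

definition add_rec :: recf where
  "add_rec = PrimRec (Proj 0) (Comp Succ [Proj 1])"

lemma rec_eval_add: "rec_eval add_rec [m, n] (m + n)"
proof (induction m)
  case 0
  show ?case unfolding add_rec_def by (auto intro: rec_eval.prim_0 rec_eval_Proj)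
next
  case (Suc m)
  then show ?case
    unfolding add_rec_def using rec_eval.prim_Suc[OF _ rec_eval_Suc[OF rec_eval_Proj(2)]] by simp
qed

definition triangle_rec :: recf where
  "triangle_rec = PrimRec Zero (Comp Succ [add_rec])"

lemma rec_eval_triangle: "rec_eval triangle_rec [n] (triangle n)"
proof (induction n)
  case 0
  show ?case unfolding triangle_rec_def by (auto intro: rec_eval.prim_0 rec_eval.zero)
next
  case (Suc n)
  have "rec_eval (PrimRec Zero (Comp Succ [add_rec])) [Suc n] (Suc (n + triangle n))"
    using Suc unfolding triangle_rec_def by (rule rec_eval.prim_Suc) (rule rec_eval_Suc, rule rec_eval_add)
  then show ?case by (simp add: triangle_rec_def add.commute)
qed

text \<open>Cantor pairing is \<open>triangle (x + y) + x\<close>. The outer composition hands the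
  values of \<open>u\<close> and \<open>v\<close> to this formula.\<close>

definition pair_rec :: "recf \<Rightarrow> recf \<Rightarrow> recf" where
  "pair_rec u v = Comp (Comp add_rec [Comp triangle_rec [add_rec], Proj 0]) [u, v]"

lemma rec_eval_pair: "rec_eval u xs x \<Longrightarrow> rec_eval v xs y \<Longrightarrow> rec_eval (pair_rec u v) xs (prod_encode (x, y))"
  unfolding pair_rec_def prod_encode_def prod.case
  by (rule rec_eval_comp2, assumption+, rule rec_eval_comp2, rule rec_eval_comp1, rule rec_eval_add,
      rule rec_eval_triangle, rule rec_eval_Proj, rule rec_eval_add)

definition cons_rec :: "recf \<Rightarrow> recf \<Rightarrow> recf" where
  "cons_rec u v = Comp Succ [pair_rec u v]"

text \<open>The clause of \<open>list_encode\<close> for a nonempty list, with \<open>y\<close> the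
  code of the tail; 0 codes the empty list.\<close>

definition cons_code :: "nat \<Rightarrow> nat \<Rightarrow> nat" where
  "cons_code x y = Suc (prod_encode (x, y))"

lemma rec_eval_cons: "rec_eval u xs x \<Longrightarrow> rec_eval v xs y \<Longrightarrow> rec_eval (cons_rec u v) xs (cons_code x y)"
  unfolding cons_rec_def cons_code_def by (intro rec_eval_Suc rec_eval_pair)

definition tuple_code :: "nat \<Rightarrow> nat \<Rightarrow> nat" where
  "tuple_code x y = cons_code (prod_encode (0, x)) (cons_code (prod_encode (1, y)) 0)"

definition tuple_rec :: "recf \<Rightarrow> recf \<Rightarrow> recf" where
  "tuple_rec u v = cons_rec (pair_rec (const_rec 0) u) (cons_rec (pair_rec (const_rec 1) v) (const_rec 0))"

lemma rec_eval_tuple: "rec_eval u xs x \<Longrightarrow> rec_eval v xs y \<Longrightarrow> rec_eval (tuple_rec u v) xs (tuple_code x y)"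
  unfolding tuple_rec_def tuple_code_def by (intro rec_eval_cons rec_eval_pair rec_eval_const)

primrec chain_code :: "nat \<Rightarrow> nat" where
  "chain_code 0 = 0"
| "chain_code (Suc n) = cons_code (tuple_code n (Suc n)) (chain_code n)"

definition chain_rec :: recf where
  "chain_rec = PrimRec Zero (cons_rec (tuple_rec (Proj 0) (Comp Succ [Proj 0])) (Proj 1))"

lemma rec_eval_chain: "rec_eval chain_rec [n] (chain_code n)"
proof (induction n)
  case 0
  show ?case unfolding chain_rec_def by (auto intro: rec_eval.prim_0 rec_eval.zero)
next
  case (Suc n)
  then show ?case
    unfolding chain_rec_def chain_code.simps
    by (rule rec_eval.prim_Suc) (intro rec_eval_cons rec_eval_tuple rec_eval_Suc rec_eval_Proj)
qed

text \<open>The schema entry of a binary relation: \<open>cons_code 0 (cons_code 1 0)\<close> codes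
  its two attributes.\<close>

definition entry_code :: "rsym \<Rightarrow> nat \<Rightarrow> nat" where
  "entry_code R n = prod_encode (to_nat R, prod_encode (cons_code 0 (cons_code 1 0), n))"

definition entry_rec :: "rsym \<Rightarrow> recf \<Rightarrow> recf" where
  "entry_rec R u = pair_rec (const_rec (to_nat R)) (pair_rec (const_rec (cons_code 0 (cons_code 1 0))) u)"

lemma rec_eval_entry: "rec_eval u xs x \<Longrightarrow> rec_eval (entry_rec R u) xs (entry_code R x)"
  unfolding entry_rec_def entry_code_def by (intro rec_eval_pair rec_eval_const)

text \<open>Only the extensions of \<open>SucR\<close> and \<open>InR\<close> vary with
  \<open>a\<close> and \<open>b\<close>; \<open>n\<close> codes all other entries.\<close>

definition start_code :: "nat \<Rightarrow> nat \<Rightarrow> nat \<Rightarrow> nat" where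
  "start_code a b n = cons_code (entry_code SucR (chain_code (a + b)))
     (cons_code (entry_code InR (cons_code (tuple_code a b) 0)) n)"

text \<open>The self-reference: the first argument is both an input and the code of the fixed part
  of the instance, the second both an input and the code of procedures and query.\<close>

definition input_rec :: recf where
  "input_rec = pair_rec (cons_rec (entry_rec SucR (Comp chain_rec [add_rec]))
     (cons_rec (entry_rec InR (cons_rec (tuple_rec (Proj 0) (Proj 1)) (const_rec 0))) (Proj 0))) (Proj 1)"

lemma rec_eval_input: "rec_eval input_rec [a, b] (prod_encode (start_code a b a, b))"
  unfolding input_rec_def start_code_def
  by (intro rec_eval_pair rec_eval_cons rec_eval_entry rec_eval_tuple rec_eval_const rec_eval_Proj
      rec_eval_comp1[OF rec_eval_add rec_eval_chain])

section \<open>Correctness of the codes\<close>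

lemma codes_set_empty: "codes_set r {} 0"
  by (simp add: codes_set_def rel_set_def)

text \<open>Codes of sets may repeat elements, so it does not matter whether \<open>x\<close> is
  new.\<close>

lemma codes_set_insert: "r x c \<Longrightarrow> codes_set r X n \<Longrightarrow> codes_set r (insert x X) (cons_code c n)"
  by (auto simp: codes_set_def rel_set_def cons_code_def)

lemma codes_tuple_code: "codes_tuple (tup [x, y]) (tuple_code x y)"
proof -
  have "Map.graph (tup [x, y]) = {(Attr 0, Val x), (Attr 1, Val y)}"
  proof (intro set_eqI)
    fix p :: "attr \<times> val"
    obtain i v where "p = (Attr i, v)" by (metis attr.exhaust surj_pair)
    then show "p \<in> Map.graph (tup [x, y]) \<longleftrightarrow> p \<in> {(Attr 0, Val x), (Attr 1, Val y)}"
      by (cases i) (auto simp: Map.graph_def tup_def less_Suc_eq)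
  qed
  then show ?thesis
    unfolding codes_tuple_def tuple_code_def
    by (simp only:) (intro codes_set_insert codes_set_empty; simp add: codes_pair_def codes_by_def)
qed

lemma codes_chain: "codes_set codes_tuple (tup ` (\<lambda>i. [i, Suc i]) ` {..<n}) (chain_code n)"
proof (induction n)
  case 0
  show ?case by (simp add: codes_set_empty)
next
  case (Suc n)
  then show ?case
    using codes_set_insert[OF codes_tuple_code Suc, of n "Suc n"] by (simp add: lessThan_Suc)
qed

lemma codes_entry:
  assumes "arity R = 2" "codes_set codes_tuple X n"
  shows "codes_pair (codes_by rel_no) (codes_pair (codes_set (codes_by attr_no)) (codes_set codes_tuple))
    (rel_of R, attrs (arity R), X) (entry_code R n)"
proof -
  have "attrs 2 = {Attr 0, Attr 1}" by (auto simp: attrs_def lessThan_Suc numeral_2_eq_2)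
  then have "codes_set (codes_by attr_no) (attrs 2) (cons_code 0 (cons_code 1 0))"
    by (simp only:) (intro codes_set_insert codes_set_empty; simp add: codes_by_def)
  with assms show ?thesis
    by (simp add: codes_pair_def entry_code_def) (simp add: codes_by_def rel_of_def)
qed

lemma db_of_entries:
  "{(R, A, ext (db_of Rs E) R) |R A. sch (db_of Rs E) R = Some A} = (\<lambda>R. (rel_of R, attrs (arity R), tup ` E R)) ` Rs"
  by (auto simp: db_of_def schema_of_def)

lemma codes_start:
  assumes "codes_db (db_of (halt_rels q - {SucR, InR}) (start_facts 0 0)) n"
  shows "codes_db (start q a b) (start_code a b n)"
proof -
  let ?e = "\<lambda>a b R. (rel_of R, attrs (arity R), tup ` start_facts a b R)"
  have "halt_rels q = insert SucR (insert InR (halt_rels q - {SucR, InR}))"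
    using halt_rels_base by blast
  from arg_cong[OF this, of "image (?e a b)"]
  have "?e a b ` halt_rels q = insert (?e a b SucR) (insert (?e a b InR) (?e a b ` (halt_rels q - {SucR, InR})))"
    by (simp only: image_insert)
  \<comment> \<open>The remaining extensions do not depend on the inputs, so those for inputs 0 and
    0 serve for all.\<close>
  also have "?e a b ` (halt_rels q - {SucR, InR}) = ?e 0 0 ` (halt_rels q - {SucR, InR})"
    by (intro image_cong refl) (auto simp: start_facts_def split: rsym.splits)
  finally have e: "?e a b ` halt_rels q = insert (?e a b SucR) (insert (?e a b InR)
      (?e 0 0 ` (halt_rels q - {SucR, InR})))" .
  show ?thesis
    unfolding codes_db_def start_def db_of_entries e start_code_def
  proof (intro codes_set_insert codes_entry)
    show "codes_set codes_tuple (tup ` start_facts a b SucR) (chain_code (a + b))"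
      using codes_chain by (simp add: start_facts_def)
    show "codes_set codes_tuple (tup ` start_facts a b InR) (cons_code (tuple_code a b) 0)"
      using codes_set_insert[of codes_tuple, OF codes_tuple_code codes_set_empty]
      by (simp add: start_facts_def)
    show "codes_set (codes_pair (codes_by rel_no) (codes_pair (codes_set (codes_by attr_no)) (codes_set codes_tuple)))
        (?e 0 0 ` (halt_rels q - {SucR, InR})) n"
      using assms unfolding codes_db_def db_of_entries .
  qed simp_all
qed

section \<open>The diagonal argument\<close>

theorem proposition11:
  "\<not> decidable_on codes_input readiness_inputs query_readiness \<and>
   \<not> decidable_on codes_input
       {(I, \<Pi>, Q) \<in> readiness_inputs. (\<forall>P\<in>\<Pi>. safe_scope P) \<and> (\<exists>a. cq_atoms Q = [a])}
       query_readiness"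
proof -
  let ?X = "{(I, \<Pi>, Q) \<in> readiness_inputs. (\<forall>P\<in>\<Pi>. safe_scope P) \<and> (\<exists>a. cq_atoms Q = [a])}"
  have "\<not> decidable_on codes_input ?X query_readiness"
  proof
    assume "decidable_on codes_input ?X query_readiness"
    then obtain f where f: "\<And>x n. x \<in> ?X \<Longrightarrow> codes_input x n \<Longrightarrow>
        rec_eval f [n] (if x \<in> query_readiness then 1 else 0)"
      unfolding decidable_on_def by blast
    \<comment> \<open>There is no circle: \<open>q\<close> depends on \<open>f\<close> only, and
      \<open>a\<close> and \<open>b\<close> are chosen afterwards from the schema and rules of
      \<open>q\<close>.\<close>
    define q where "q = Comp f [input_rec]"
    let ?x = "\<lambda>a b. (start q a b, proc_of ` halt_rules q, halt_query)"
    have "over (halt_rels q - {SucR, InR}) (db_of (halt_rels q - {SucR, InR}) (start_facts 0 0))"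
      by (rule over_start_facts) (simp add: program.finite_rels[OF halt_program])
    then obtain a where a: "codes_db (db_of (halt_rels q - {SucR, InR}) (start_facts 0 0)) a"
      using codes_db_ex unfolding over_def by blast
    have "\<exists>b. codes_pair (codes_set codes_proc) (codes_by enc_cq) (proc_of ` halt_rules q, halt_query) b"
      by (intro codes_pair_ex codes_set_ex codes_by_ex)
        (auto simp: finite_halt_rules intro: codes_proc_ex wf_proc_of ok_halt_rules)
    then obtain b where b: "codes_pair (codes_set codes_proc) (codes_by enc_cq)
        (proc_of ` halt_rules q, halt_query) b" by blast
    have "codes_input (?x a b) (prod_encode (start_code a b a, b))"
      using codes_start[OF a] b by (simp add: codes_input_def codes_pair_def[of codes_db])
    with halt_inputs have "rec_eval f [prod_encode (start_code a b a, b)]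
        (if ?x a b \<in> query_readiness then 1 else 0)"
      by (rule f)
    then have q: "rec_eval q [a, b] (if ?x a b \<in> query_readiness then 1 else 0)"
      unfolding q_def by (rule rec_eval_comp1[OF rec_eval_input])
    \<comment> \<open>If the input is ready, \<open>q\<close> yields both 1 and 0, against
      determinism. If it is not, \<open>q\<close> yields 0, which makes it ready.\<close>
    show False
    proof (cases "?x a b \<in> query_readiness")
      case True
      then have "rec_eval q [a, b] 0" by (simp only: halt_readiness)
      with True q show False by (auto dest: rec_eval_deterministic)
    next
      case False
      with q have "rec_eval q [a, b] 0" by simp
      with False show False using halt_readiness by blast
    qed
  qed
  \<comment> \<open>A decider for all inputs also decides the restricted class.\<close>
  moreover have "decidable_on codes_input ?X query_readiness"
    if "decidable_on codes_input readiness_inputs query_readiness"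
    using that unfolding decidable_on_def by blast
  ultimately show ?thesis by blast
qed

end
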